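(* Fix a positive real constant $\epsilon$, a positive integer $s$, and a probability parameter $p\in(0,1)$; let $q=1/p$ and $z=2\log_q n-2\log_q\log_q n+2\log_q(e/2)+1$. For a random graph $\Gamma\in\mathcal{G}(n,p)$ let $K_\Gamma$ be the Eilenberg–MacLane space associated to the right angled Artin group defined by $\Gamma$, and consider the random variable $\mathrm{TC}_s(\Gamma)=\mathrm{TC}_s(K_\Gamma)$. Then $$\lim_{n\to\infty}\mathrm{Prob}\left(s\lfloor z-\epsilon\rfloor\le \mathrm{TC}_s\le s\lfloor z+\epsilon\rfloor\right)=1.$$
   Context: $\mathcal{G}(n,p)$: random graphs on vertex set $[n]=\{1,\dots,n\}$ in which each possible edge is included independently with probability $p$ ($p$ fixed). For a graph $\Gamma$ on $[n]$, the right angled Artin group is $G_\Gamma=\langle v\in[n]\,;\, vw=wv \text{ iff } \{v,w\}\text{ is an edge of }\Gamma\rangle$. Concretely $K_\Gamma$ is the subcomplex of the torus $T^n=(S^1)^n$ (with $S^1=e^0\cup e^1$ and product cells $e_J=\{(x_1,\dots,x_n): x_i=e^0 \iff i\notin J\}$, $J\subseteq[n]$) consisting of the cells $e_J$ with $J$ spanning a complete subgraph of $\Gamma$; it is an Eilenberg–MacLane space of type $(G_\Gamma,1)$. For $s\ge2$ and a path-connected space $X$, $\mathrm{TC}_s(X)$ (Rudyak's $s$-th higher topological complexity) is the least integer $k\ge0$ such that $X^s$ can be covered by $k+1$ open sets on each of which the map $e_s:X^{J_s}\to X^s$, $(f_1,\dots,f_s)\mapsto(f_1(1),\dots,f_s(1))$,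 admits a continuous section; here $J_s$ is the wedge of $s$ copies of $[0,1]$ joined at $0$. For $s=1$, $\mathrm{TC}_1(K_\Gamma)$ is taken to be the Lusternik–Schnirelmann category $\mathrm{cat}(K_\Gamma)$ (reduced, so contractible spaces have category $0$). *)

theory Defs
  imports "HOL-Probability.Probability" "HOL-Library.Ramsey"
begin

text \<open>A graph on \<open>{1..n}\<close> is given by its edge set, a set of two-element subsets of \<open>{1..n}\<close>.\<close>

definition random_graph :: "nat \<Rightarrow> real \<Rightarrow> nat set set pmf" where
  "random_graph n p =
     map_pmf (\<lambda>b. {e. b e}) (Pi_pmf (nsets {1..n} 2) False (\<lambda>_. bernoulli_pmf p))"

text \<open>The circle is the unit circle of the complex plane, with 0-cell \<open>e\<^sup>0 = {1}\<close>.\<close>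

definition torus :: "nat \<Rightarrow> (nat \<Rightarrow> complex) topology" where
  "torus n = product_topology (\<lambda>_. top_of_set (sphere 0 1)) {1..n}"

definition torus_cell :: "nat \<Rightarrow> nat set \<Rightarrow> (nat \<Rightarrow> complex) set" where
  "torus_cell n J = {x \<in> topspace (torus n). \<forall>i\<in>{1..n}. x i = 1 \<longleftrightarrow> i \<notin> J}"

definition raag_complex :: "nat \<Rightarrow> nat set set \<Rightarrow> (nat \<Rightarrow> complex) topology" where
  "raag_complex n E =
     subtopology (torus n) (\<Union>J\<in>{J. J \<subseteq> {1..n} \<and> clique J E}. torus_cell n J)"

text \<open>
  The reduced number of open sets with property \<open>P\<close> needed to cover a space:
  \<open>k + 1\<close> sets count as \<open>k\<close>, and the value is \<open>\<infinity>\<close> if no finite cover exists.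
\<close>

definition open_cover_number :: "'a topology \<Rightarrow> ('a set \<Rightarrow> bool) \<Rightarrow> enat" where
  "open_cover_number X P =
     Inf {enat k |k. \<exists>U. (\<forall>i\<in>{0..k}. openin X (U i) \<and> P (U i)) \<and> topspace X \<subseteq> (\<Union>i\<in>{0..k}. U i)}"

definition LS_category :: "'a topology \<Rightarrow> enat" where
  "LS_category X =
     open_cover_number X (\<lambda>U. \<exists>a. homotopic_with (\<lambda>_. True) (subtopology X U) X (\<lambda>x. x) (\<lambda>_. a))"

definition quotient_topology :: "'a topology \<Rightarrow> ('a \<Rightarrow> 'b) \<Rightarrow> 'b topology" where
  "quotient_topology X q =
     topology (\<lambda>U. U \<subseteq> q ` topspace X \<and> openin X {x \<in> topspace X. q x \<in> U})"

lemma openin_quotient_topology: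
  "openin (quotient_topology X q) U \<longleftrightarrow>
     U \<subseteq> q ` topspace X \<and> openin X {x \<in> topspace X. q x \<in> U}"
proof -
  have "istopology (\<lambda>U. U \<subseteq> q ` topspace X \<and> openin X {x \<in> topspace X. q x \<in> U})"
    unfolding istopology_def
  proof (intro conjI allI impI)
    fix S T
    assume S: "S \<subseteq> q ` topspace X \<and> openin X {x \<in> topspace X. q x \<in> S}"
      and T: "T \<subseteq> q ` topspace X \<and> openin X {x \<in> topspace X. q x \<in> T}"
    show "S \<inter> T \<subseteq> q ` topspace X"
      using S by blast
    have "{x \<in> topspace X. q x \<in> S \<inter> T} = {x \<in> topspace X. q x \<in> S} \<inter> {x \<in> topspace X. q x \<in> T}"
      by blast
    then show "openin X {x \<in> topspace X. q x \<in> S \<inter> T}"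
      using S T by (simp add: openin_Int)
  next
    fix \<K>
    assume K: "\<forall>K\<in>\<K>. K \<subseteq> q ` topspace X \<and> openin X {x \<in> topspace X. q x \<in> K}"
    then show "\<Union>\<K> \<subseteq> q ` topspace X"
      by blast
    have "{x \<in> topspace X. q x \<in> \<Union>\<K>} = (\<Union>K\<in>\<K>. {x \<in> topspace X. q x \<in> K})"
      by blast
    then show "openin X {x \<in> topspace X. q x \<in> \<Union>\<K>}"
      using K by auto
  qed
  then show ?thesis
    by (simp add: quotient_topology_def)
qed

lemma topspace_quotient_topology [simp]: "topspace (quotient_topology X q) = q ` topspace X"
proof
  show "topspace (quotient_topology X q) \<subseteq> q ` topspace X"
    using openin_quotient_topology[of X q "topspace (quotient_topology X q)"] by simp
  have "{x \<in> topspace X. q x \<in> q ` topspace X} = topspace X"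
    by blast
  then have "openin (quotient_topology X q) (q ` topspace X)"
    by (simp add: openin_quotient_topology)
  then show "q ` topspace X \<subseteq> topspace (quotient_topology X q)"
    by (rule openin_subset)
qed

lemma quotient_map_quotient_topology: "quotient_map X (quotient_topology X q) q"
  by (auto simp: quotient_map_def openin_quotient_topology)

text \<open>
  The wedge \<open>J\<^sub>s\<close> of intervals. The point \<open>t\<close> of the \<open>i\<close>-th interval, \<open>1 \<le> i \<le> s\<close>, is represented
  by \<open>(i, t)\<close> if \<open>t > 0\<close>, and the common point \<open>0\<close> of all the intervals is represented by \<open>(0, 0)\<close>.
\<close>

definition interval_wedge :: "nat \<Rightarrow> (nat \<times> real) topology" where
  "interval_wedge s =
     quotient_topology (sum_topology (\<lambda>_. top_of_set {0..1}) {1..s})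
       (\<lambda>(i, t). if t = 0 then (0, 0) else (i, t))"

text \<open>
  The mapping space \<open>X\<^sup>Y\<close> with the compact-open topology. Its points are taken to be undefined
  outside \<open>Y\<close>, so that they are determined by their restriction to \<open>Y\<close>.
\<close>

definition compact_open_topology :: "'a topology \<Rightarrow> 'b topology \<Rightarrow> ('a \<Rightarrow> 'b) topology" where
  "compact_open_topology Y X =
     topology_generated_by
       {{f \<in> extensional (topspace Y). continuous_map Y X f \<and> f ` C \<subseteq> U} |C U.
          compactin Y C \<and> openin X U}"

lemma topspace_compact_open_topology [simp]:
  "topspace (compact_open_topology Y X) = {f \<in> extensional (topspace Y). continuous_map Y X f}"
proof -
  have "compactin Y {}" "openin X {}"
    by auto
  then show ?thesis
    unfolding compact_open_topology_def topology_generated_by_topspace by blast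
qed

definition endpoint_map :: "nat \<Rightarrow> (nat \<times> real \<Rightarrow> 'a) \<Rightarrow> nat \<Rightarrow> 'a" where
  "endpoint_map s f = (\<lambda>i\<in>{1..s}. f (i, 1))"

text \<open>
  For \<open>s = 1\<close> the fibration always has a global section; the convention is that the
  Lusternik-Schnirelmann category is used instead.
\<close>

definition higher_TC :: "nat \<Rightarrow> 'a topology \<Rightarrow> enat" where
  "higher_TC s X =
     (if s = 1 then LS_category X
      else open_cover_number (product_topology (\<lambda>_. X) {1..s})
        (\<lambda>U. \<exists>\<sigma>. continuous_map (subtopology (product_topology (\<lambda>_. X) {1..s}) U)
                      (compact_open_topology (interval_wedge s) X) \<sigma> \<and>
                 (\<forall>x\<in>U. endpoint_map s (\<sigma> x) = x)))"

definition clique_threshold :: "real \<Rightarrow> nat \<Rightarrow> real" where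
  "clique_threshold p n =
     (let q = 1 / p in
        2 * log q (real n) - 2 * log q (log q (real n)) + 2 * log q (exp 1 / 2) + 1)"

end

theory Submission
  imports Defs "HOL-Real_Asymp.Real_Asymp"
begin

text \<open>
  Upper bound: a point of \<open>K\<^sup>s\<close> has at most \<open>s \<omega>\<close> circle coordinates different from \<open>1\<close>, where
  \<open>\<omega>\<close> is the clique number. Singling out the \<open>d\<close> coordinates farthest from \<open>1\<close>, for
  \<open>d = 0, \<dots>, s \<omega>\<close>, gives \<open>s \<omega> + 1\<close> open sets on which all coordinates have continuous arguments,
  and shrinking the arguments to \<open>0\<close> contracts each of these sets inside \<open>K\<^sup>s\<close>.

  Lower bound: two disjoint \<open>k\<close>-cliques span an \<open>sk\<close>-dimensional torus in \<open>K\<^sup>s\<close>. On an open set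
  with a section every circle coordinate of this torus is inessential, because the corresponding
  coordinate of another factor is constantly \<open>1\<close> and the section provides a homotopy between
  the two. By Kuhn's combinatorial lemma, the torus is not covered by \<open>sk\<close> such sets. For \<open>s = 1\<close> a
  null homotopy plays the role of the section.

  Thus it suffices that the clique number is at most \<open>\<lfloor>z + \<epsilon>\<rfloor>\<close>, which follows from
  the first moment method, and that two disjoint cliques of size \<open>\<lfloor>z - \<epsilon>\<rfloor>\<close> exist, which follows
  from the second moment method.
\<close>

section \<open>Open covers of tori\<close>

text \<open>The lower bound needs no cohomology: it is a Lebesgue covering argument on the universal
  cover of an m-torus. If the i-th circle coordinate is inessential on the i-th set, then on the
  grid points of that set the i-th real coordinate differs from a locally constant function by a
  bounded amount. A connected piece of the set is therefore bounded in direction i, and m such sets,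
  one for each direction, cannot cover a large cube. Two disjoint cliques serve every
  \<open>s\<close> \<ge> 2, because a factor only needs some other factor whose clique misses its
  own. Asking for a disjoint pair costs nothing beyond the existence of one clique: the intersecting
  pairs are what the variance estimate has to control anyway. Since k! is (k/e)^k up to a factor
  polynomial in k, the expected number of k-cliques is roughly (e n / k * p^((k-1)/2))^k. With k in
  the denominator replaced by 2 log_q n, the base equals 1 exactly at k = z. Moving k by \<epsilon>
  changes the base by a factor q^(\<epsilon>/2) in one direction or the other; half of this exponent
  pays for the lower order errors, and q^(-\<epsilon>/4) per factor is what remains in both moment
  estimates.\<close>

lemma continuous_log_unique:
  fixes f :: "'a::topological_space \<Rightarrow> complex"
  assumes "connected S" "continuous_on S f" "\<And>x. x \<in> S \<Longrightarrow> exp (f x) = c" "x \<in> S" "y \<in> S"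
  shows "f x = f y"
proof -
  \<comment> \<open>Logarithms of the same number differ by multiples of 2 pi i, so the values of
    \<open>f\<close> have gaps of at least 2 pi.\<close>
  have "f constant_on S"
  proof (rule continuous_discrete_range_constant[OF assms(1,2)])
    fix x assume x: "x \<in> S"
    have "2 * pi \<le> norm (f y - f x)" if y: "y \<in> S" "f y \<noteq> f x" for y
    proof -
      have "exp (f y) = exp (f x)"
        using assms(3) x y by metis
      then obtain n :: int where n: "f y = f x + complex_of_real (2 * of_int n * pi) * \<i>"
        by (auto simp: exp_eq)
      with y have "n \<noteq> 0" by auto
      then have "1 \<le> \<bar>real_of_int n\<bar>" by linarith
      moreover have "norm (f y - f x) = 2 * \<bar>real_of_int n\<bar> * pi"
        using n by (simp add: norm_mult)
      ultimately show ?thesis by simp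
    qed
    then show "\<exists>e>0. \<forall>y. y \<in> S \<and> f y \<noteq> f x \<longrightarrow> e \<le> norm (f y - f x)"
      by (intro exI[of _ "2*pi"]) auto
  qed
  then show ?thesis
    using assms(4,5) by (auto simp: constant_on_def)
qed

text \<open>The increment of a continuous logarithm along a path; its imaginary part is the total
  change of argument. By \<open>log_change_eqI\<close> every continuous logarithm gives the same
  value. For a path without one the value is arbitrary.\<close>

definition log_change :: "(real \<Rightarrow> complex) \<Rightarrow> complex" where
  "log_change f =
     (SOME r. \<exists>g. continuous_on {0..1} g \<and> (\<forall>t\<in>{0..1}. f t = exp (g t)) \<and> r = g 1 - g 0)"

lemma log_change_eqI:
  assumes "continuous_on {0..1} g" "\<And>t. t \<in> {0..1} \<Longrightarrow> f t = exp (g t)"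
  shows "log_change f = g 1 - g 0"
proof -
  have "\<exists>g'. continuous_on {0..1} g' \<and> (\<forall>t\<in>{0..1}. f t = exp (g' t)) \<and> log_change f = g' 1 - g' 0"
    unfolding log_change_def
    by (rule someI[of _ "g 1 - g 0"]) (use assms in auto)
  then obtain g' where g': "continuous_on {0..1} g'" "\<And>t. t \<in> {0..1} \<Longrightarrow> f t = exp (g' t)"
    "log_change f = g' 1 - g' 0"
    by blast
  have "g' 0 - g 0 = g' 1 - g 1"
    by (rule continuous_log_unique[where S = "{0..1}" and c = 1 and f = "\<lambda>t. g' t - g t"])
      (use g' assms in \<open>auto intro!: continuous_intros simp: exp_diff\<close>)
  then have "g' 1 = g' 0 - g 0 + g 1"
    by simp
  then show ?thesis
    using g'(3) by simp
qed

lemma log_change_cong: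
  assumes "\<And>t. t \<in> {0..1} \<Longrightarrow> f t = g t"
  shows "log_change f = log_change g"
  using assms unfolding log_change_def by (intro arg_cong[where f = Eps] ext) auto

text \<open>The square is contractible, so a single logarithm of \<open>F\<close> serves all
  \<open>u\<close> at once and the increment is a difference of its values on two opposite
  sides.\<close>

lemma log_change_homotopy:
  fixes F :: "real \<times> real \<Rightarrow> complex"
  assumes "continuous_on ({0..1} \<times> {0..1}) F" "\<And>z. z \<in> {0..1} \<times> {0..1} \<Longrightarrow> F z \<noteq> 0"
  shows "continuous_on {0..1} (\<lambda>u. log_change (\<lambda>t. F (t, u)))"
    and "u \<in> {0..1} \<Longrightarrow> exp (log_change (\<lambda>t. F (t, u))) = F (1, u) / F (0, u)"
proof -
  have "contractible ({0..1::real} \<times> {0..1::real})"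
    by (intro convex_imp_contractible convex_Times) auto
  then obtain g where g: "continuous_on ({0..1} \<times> {0..1}) g"
      "\<And>z. z \<in> {0..1} \<times> {0..1} \<Longrightarrow> F z = exp (g z)"
    using continuous_logarithm_on_contractible assms by metis
  have g1: "continuous_on {0..1} (\<lambda>t. g (t, u))" if "u \<in> {0..1}" for u
    by (rule continuous_on_compose2[OF g(1)]) (use that in \<open>auto intro!: continuous_intros\<close>)
  have g2: "continuous_on {0..1} (\<lambda>u. g (t, u))" if "t \<in> {0..1}" for t
    by (rule continuous_on_compose2[OF g(1)]) (use that in \<open>auto intro!: continuous_intros\<close>)
  have eq: "log_change (\<lambda>t. F (t, u)) = g (1, u) - g (0, u)" if "u \<in> {0..1}" for u
    by (rule log_change_eqI[OF g1[OF that]]) (use g that in auto)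
  show "continuous_on {0..1} (\<lambda>u. log_change (\<lambda>t. F (t, u)))"
    by (subst continuous_on_cong[OF refl eq]) (auto intro!: continuous_intros g2)
  show "exp (log_change (\<lambda>t. F (t, u))) = F (1, u) / F (0, u)" if "u \<in> {0..1}"
    using that g(2) by (simp add: eq exp_diff)
qed

text \<open>The metric weights the n-th coordinate by (1/2)^n, and these weights sum to 2. This
  converts a Lebesgue number into a mesh size for the grid.\<close>

lemma dist_fun_le:
  fixes x y :: "'a::countable \<Rightarrow> 'b::metric_space"
  assumes "\<And>i. dist (x i) (y i) \<le> e"
  shows "dist x y \<le> 2 * e"
proof -
  have s: "summable (\<lambda>n. (1/2)^n * e)"
    by (intro summable_mult2) (simp add: summable_geometric)
  have le: "(1/2)^n * min (dist (x (from_nat n)) (y (from_nat n))) 1 \<le> (1/2)^n * e" for n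
    by (intro mult_left_mono) (use assms[of "from_nat n"] in auto)
  have "dist x y \<le> (\<Sum>n. (1/2)^n * e)"
    unfolding dist_fun_def
    by (intro suminf_le le s summable_comparison_test'[OF s, of 0]) (use le in auto)
  also have "\<dots> = 2 * e"
    using suminf_geometric[of "1/2::real"] by (subst suminf_mult2[symmetric]) (auto simp: summable_geometric)
  finally show ?thesis .
qed

text \<open>Pinning the coordinates from \<open>m\<close> on to 0 makes the cube a compact product
  inside the full function space.\<close>

lemma compact_cube:
  fixes m :: nat and b :: real
  shows "compact {\<theta>. (\<forall>j<m. \<theta> j \<in> {0..b}) \<and> (\<forall>j\<ge>m. \<theta> j = 0)}"
proof -
  have "compactin (product_topology (\<lambda>_. euclidean) UNIV)
          (PiE UNIV (\<lambda>j. if j < m then {0..b} else {0::real}))"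
    by (subst compactin_PiE) auto
  moreover have "PiE UNIV (\<lambda>j. if j < m then {0..b} else {0}) =
      {\<theta>. (\<forall>j<m. \<theta> j \<in> {0..b}) \<and> (\<forall>j\<ge>m. \<theta> j = 0)}"
    by (force simp: PiE_def Pi_def)
  ultimately show ?thesis
    by (simp add: euclidean_product_topology)
qed

text \<open>
  On \<open>V i\<close> the homotopy \<open>h i\<close> provides a periodic argument of \<open>cis (\<theta> i)\<close>. The difference between
  \<open>\<theta> i\<close> and this argument is locally constant, and whether it is small or large defines a
  labelling of a fine grid in a large cube to which Kuhn's lemma applies.
\<close>

lemma torus_not_covered:
  fixes m :: nat and V :: "nat \<Rightarrow> (nat \<Rightarrow> real) set"
    and h :: "nat \<Rightarrow> real \<Rightarrow> (nat \<Rightarrow> real) \<Rightarrow> complex" and c :: "nat \<Rightarrow> complex"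
  assumes op: "\<And>i. i < m \<Longrightarrow> open (V i)"
    and cover: "\<And>\<theta>. \<exists>i<m. \<theta> \<in> V i"
    and perV: "\<And>i \<theta> \<theta>'. i < m \<Longrightarrow> \<theta> \<in> V i \<Longrightarrow> (\<And>j. j < m \<Longrightarrow> cis (\<theta> j) = cis (\<theta>' j)) \<Longrightarrow> \<theta>' \<in> V i"
    and perh: "\<And>i \<theta> \<theta>' t. i < m \<Longrightarrow> \<theta> \<in> V i \<Longrightarrow> (\<And>j. j < m \<Longrightarrow> cis (\<theta> j) = cis (\<theta>' j)) \<Longrightarrow>
        t \<in> {0..1} \<Longrightarrow> h i t \<theta> = h i t \<theta>'"
    and cont: "\<And>i. i < m \<Longrightarrow> continuous_on ({0..1} \<times> V i) (\<lambda>(t, \<theta>). h i t \<theta>)"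
    and nz: "\<And>i \<theta> t. i < m \<Longrightarrow> \<theta> \<in> V i \<Longrightarrow> t \<in> {0..1} \<Longrightarrow> h i t \<theta> \<noteq> 0"
    and ends: "\<And>i \<theta>. i < m \<Longrightarrow> \<theta> \<in> V i \<Longrightarrow> h i 1 \<theta> = c i * cis (\<theta> i) * h i 0 \<theta>"
  shows False
proof -
  define D where "D = (\<lambda>i \<theta>. \<theta> i - Im (log_change (\<lambda>t. h i t \<theta>)))"
  have D_const: "D i \<theta> = D i \<theta>'"
    if i: "i < m" and seg: "\<And>u. u \<in> {0..1} \<Longrightarrow> (\<lambda>j. \<theta> j + u * (\<theta>' j - \<theta> j)) \<in> V i" for i \<theta> \<theta>'
  proof -
    define \<gamma> where "\<gamma> = (\<lambda>u j. \<theta> j + u * (\<theta>' j - \<theta> j))"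
    have \<gamma>: "\<gamma> u \<in> V i" if "u \<in> {0..1}" for u
      using seg that by (simp add: \<gamma>_def)
    have \<gamma>_cont: "continuous_on UNIV \<gamma>"
      unfolding \<gamma>_def by (rule continuous_on_coordinatewise_then_product) (auto intro!: continuous_intros)
    define F where "F = (\<lambda>(t, u). h i t (\<gamma> u))"
    have "continuous_on ({0..1} \<times> {0..1}) (\<lambda>z. \<gamma> (snd z))"
      by (rule continuous_on_compose2[OF \<gamma>_cont]) (auto intro!: continuous_on_snd continuous_on_id)
    then have "continuous_on ({0..1} \<times> {0..1}) (\<lambda>z. (fst z, \<gamma> (snd z)))"
      by (intro continuous_on_Pair continuous_on_fst continuous_on_id)
    then have "continuous_on ({0..1} \<times> {0..1}) (\<lambda>z. case (fst z, \<gamma> (snd z)) of (t, \<theta>) \<Rightarrow> h i t \<theta>)"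
      by (rule continuous_on_compose2[OF cont[OF i]]) (use \<gamma> in auto)
    then have F_cont: "continuous_on ({0..1} \<times> {0..1}) F"
      by (simp add: F_def case_prod_beta)
    have F_nz: "F z \<noteq> 0" if "z \<in> {0..1} \<times> {0..1}" for z
      using that nz[OF i \<gamma>] by (auto simp: F_def)
    define L where "L = (\<lambda>u. log_change (\<lambda>t. F (t, u)))"
    have L_cont: "continuous_on {0..1} L"
      unfolding L_def by (rule log_change_homotopy(1)[OF F_cont F_nz])
    have expL: "exp (L u) = c i * cis (\<gamma> u i)" if "u \<in> {0..1}" for u
    proof -
      have "exp (L u) = F (1, u) / F (0, u)"
        unfolding L_def by (rule log_change_homotopy(2)[OF F_cont F_nz that])
      then show ?thesis
        using ends[OF i \<gamma>[OF that]] nz[OF i \<gamma>[OF that], of 0] by (simp add: F_def)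
    qed
    \<comment> \<open>By \<open>expL\<close> the expression is a continuous logarithm of the
      constant 1 / \<open>c i\<close> along the segment.\<close>
    have "\<i> * of_real (\<gamma> 0 i) - L 0 = \<i> * of_real (\<gamma> 1 i) - L 1"
    proof (rule continuous_log_unique[where S = "{0..1}" and c = "1 / c i"
            and f = "\<lambda>u. \<i> * of_real (\<gamma> u i) - L u"])
      show "continuous_on {0..1} (\<lambda>u. \<i> * complex_of_real (\<gamma> u i) - L u)"
        by (intro continuous_intros L_cont) (auto simp: \<gamma>_def intro!: continuous_intros)
      show "exp (\<i> * complex_of_real (\<gamma> u i) - L u) = 1 / c i" if "u \<in> {0..1}" for u
        using expL[OF that] by (simp add: exp_diff cis_conv_exp[symmetric])
    qed auto
    then have "Im (\<i> * of_real (\<gamma> 0 i) - L 0) = Im (\<i> * of_real (\<gamma> 1 i) - L 1)"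
      by simp
    then show ?thesis
      by (simp add: D_def L_def F_def \<gamma>_def)
  qed
  define K where "K = {\<theta>::nat \<Rightarrow> real. (\<forall>j<m. \<theta> j \<in> {0..2 * pi}) \<and> (\<forall>j\<ge>m. \<theta> j = 0)}"
  have "compact K"
    unfolding K_def by (rule compact_cube)
  moreover have "K \<subseteq> \<Union>(V ` {..<m})"
    using cover by blast
  ultimately obtain e where e: "0 < e" "\<And>\<theta>. \<theta> \<in> K \<Longrightarrow> \<exists>G\<in>V ` {..<m}. ball \<theta> e \<subseteq> G"
    using Heine_Borel_lemma[of K "V ` {..<m}"] op by (metis imageE lessThan_iff)
  \<comment> \<open>The mesh \<eta> = 2 pi / M divides the period, so that the grid can be reduced
    modulo M. The bound on M gives 2 \<eta> < e, the factor 2 coming from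
    \<open>dist_fun_le\<close>.\<close>
  obtain M :: nat where M: "M > 4 * pi / e"
    using reals_Archimedean2 by blast
  have "0 < 4 * pi / e"
    using e by simp
  with M have M0: "M > 0"
    by (cases M) auto
  define \<eta> where "\<eta> = 2 * pi / M"
  have \<eta>: "\<eta> > 0" "\<eta> * real M = 2 * pi" "2 * \<eta> < e"
    using M M0 e by (auto simp: \<eta>_def field_simps)
  define grid where "grid = (\<lambda>r j. if j < m then \<eta> * real (r j) else 0)"
  define red where "red = (\<lambda>r. \<lambda>j\<in>{..<m}. r j mod M)"
  have cis_red: "cis (\<eta> * real (k mod M) + x) = cis (\<eta> * real k + x)" for k :: nat and x
  proof -
    have "real k = real (k div M) * real M + real (k mod M)"
      by (metis div_mult_mod_eq of_nat_add of_nat_mult)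
    then have "\<eta> * real k = \<eta> * real (k mod M) + (\<eta> * real M) * real (k div M)"
      by (simp add: algebra_simps)
    then have "\<eta> * real k = \<eta> * real (k mod M) + 2 * pi * real (k div M)"
      by (simp only: \<eta>(2))
    then have "\<eta> * real k + x = (\<eta> * real (k mod M) + x) + 2 * pi * real (k div M)"
      by simp
    then have "cis (\<eta> * real k + x) = cis (\<eta> * real (k mod M) + x) * cis (2 * pi * real (k div M))"
      by (simp only: cis_mult)
    moreover have "cis (2 * pi * real (k div M)) = 1"
      by (intro cis_multiple_2pi) auto
    ultimately show ?thesis
      by simp
  qed
  have cis_grid: "cis (grid (red r) j) = cis (grid r j)" if "j < m" for r j
    using that cis_red[of "r j" 0] by (simp add: grid_def red_def)
  have fin: "finite (red ` UNIV)"
    by (rule finite_subset[of _ "PiE {..<m} (\<lambda>_. {..<M})"])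
      (use M0 in \<open>auto simp: red_def intro!: finite_PiE split: if_splits\<close>)
  \<comment> \<open>Up to periods there are only finitely many grid points, which yields a bound
    \<open>C\<close> independent of the size \<open>P\<close> of the cube chosen below. Points
    outside \<open>V i\<close> contribute meaningless but finitely many values.\<close>
  define S where "S = (\<lambda>(i, r). \<bar>Im (log_change (\<lambda>t. h i t (grid r)))\<bar>) ` ({..<m} \<times> red ` UNIV)"
  have finS: "finite S"
    unfolding S_def using fin by simp
  then obtain C where C: "\<And>x. x \<in> S \<Longrightarrow> x \<le> C"
    using bdd_above_finite[of S] by (auto simp: bdd_above_def)
  have D_bound: "\<bar>D i (grid r) - \<eta> * real (r i)\<bar> \<le> C" if i: "i < m" "grid r \<in> V i" for i r
  proof -
    have "log_change (\<lambda>t. h i t (grid r)) = log_change (\<lambda>t. h i t (grid (red r)))"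
      by (rule log_change_cong, rule perh) (use i cis_grid in auto)
    moreover have "\<bar>Im (log_change (\<lambda>t. h i t (grid (red r))))\<bar> \<le> C"
      by (rule C) (use i in \<open>auto simp: S_def\<close>)
    ultimately show ?thesis
      using i by (simp add: D_def grid_def)
  qed
  \<comment> \<open>By \<open>D_bound\<close>, \<open>D i\<close> is at most C at grid points of
    \<open>V i\<close> with \<open>r i = 0\<close>, and at least \<eta> P - C > C at those with
    \<open>r i = P\<close>.\<close>
  obtain P :: nat where P: "P > 2 * C / \<eta> " "P > 0"
    by (metis of_nat_0_less_iff reals_Archimedean2 max_less_iff_conj)
  have P': "\<eta> * real P > 2 * C"
    using P \<eta> by (simp add: field_simps)
  \<comment> \<open>The label is the test \<open>D i (grid r) \<le> C\<close>. Its values on the two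
    faces are forced so that Kuhn's boundary conditions hold outside \<open>V i\<close> too; on
    \<open>V i\<close> they agree with the test by the choice of P.\<close>
  define lab :: "(nat \<Rightarrow> nat) \<Rightarrow> nat \<Rightarrow> nat" where
    "lab = (\<lambda>r i. if r i = 0 \<or> (r i < P \<and> grid r \<in> V i \<and> D i (grid r) \<le> C) then 0 else 1)"
  obtain q where q: "\<forall>i<m. q i < P"
    "\<forall>i<m. \<exists>r s. (\<forall>j<m. q j \<le> r j \<and> r j \<le> q j + 1) \<and>
                (\<forall>j<m. q j \<le> s j \<and> s j \<le> q j + 1) \<and> lab r i \<noteq> lab s i"
  proof (rule kuhn_lemma[of P m lab, OF P(2)])
    show "\<forall>x. (\<forall>i<m. x i \<le> P) \<longrightarrow> (\<forall>i<m. lab x i = 0 \<or> lab x i = 1)"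
      "\<forall>x. (\<forall>i<m. x i \<le> P) \<longrightarrow> (\<forall>i<m. x i = 0 \<longrightarrow> lab x i = 0)"
      "\<forall>x. (\<forall>i<m. x i \<le> P) \<longrightarrow> (\<forall>i<m. x i = P \<longrightarrow> lab x i = 1)"
      using P(2) by (auto simp: lab_def)
  qed (rule that)
  have "grid (red q) \<in> K"
  proof -
    have "\<eta> * real (k mod M) \<le> 2 * pi" for k
      using M0 \<eta> by (metis less_imp_le mod_less_divisor mult_left_mono of_nat_mono)
    then show ?thesis
      using \<eta>(1) by (auto simp: K_def grid_def red_def)
  qed
  then obtain i where i: "i < m" and ball: "ball (grid (red q)) e \<subseteq> V i"
    using e(2) by blast
  \<comment> \<open>Kuhn's cube may lie far from \<open>K\<close>. The Lebesgue ball is found at the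
    reduced corner \<open>red q\<close>, the segment is checked there, and periodicity of
    \<open>V i\<close> carries it back.\<close>
  have cube: "(\<lambda>j. grid q j + u * (grid r j - grid q j)) \<in> V i"
    if r: "\<forall>j<m. q j \<le> r j \<and> r j \<le> q j + 1" and u: "u \<in> {0..1}" for r u
  proof (rule perV[OF i])
    let ?\<theta> = "\<lambda>j. grid (red q) j + u * (grid r j - grid q j)"
    have diff: "\<bar>grid r j - grid q j\<bar> \<le> \<eta>" for j
    proof (cases "j < m")
      case True
      then have "r j = q j \<or> r j = Suc (q j)"
        using r by force
      then show ?thesis
        using True \<eta> by (auto simp: grid_def algebra_simps)
    qed (use \<eta> in \<open>auto simp: grid_def\<close>)
    have d: "dist (grid (red q) j) (?\<theta> j) \<le> \<eta>" for j
      using mult_mono[of "\<bar>u\<bar>" 1 "\<bar>grid r j - grid q j\<bar>" \<eta>] diff[of j] u \<eta>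
      by (auto simp: dist_real_def abs_mult)
    have "dist (grid (red q)) ?\<theta> \<le> 2 * \<eta>"
      by (rule dist_fun_le) (rule d)
    with \<eta>(3) have "dist (grid (red q)) ?\<theta> < e"
      by linarith
    then show "?\<theta> \<in> V i"
      using ball by (auto simp: mem_ball)
    show "cis (?\<theta> j) = cis (grid q j + u * (grid r j - grid q j))" if "j < m" for j
      using cis_red[of "q j" "u * (grid r j - grid q j)"] that by (simp add: grid_def red_def)
  qed
  have gV: "grid r \<in> V i" if r: "\<forall>j<m. q j \<le> r j \<and> r j \<le> q j + 1" for r
    using cube[OF r, of 1] by simp
  have Deq: "D i (grid r) = D i (grid q)" if r: "\<forall>j<m. q j \<le> r j \<and> r j \<le> q j + 1" for r
    using D_const[OF i cube[OF r]] by simp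
  \<comment> \<open>All corners of Kuhn's cube lie in \<open>V i\<close> and share the value of
    \<open>D i\<close>, hence also the i-th label, although Kuhn's lemma provides two corners where
    it differs.\<close>
  have "lab r i = (if D i (grid q) \<le> C then 0 else 1)"
    if r: "\<forall>j<m. q j \<le> r j \<and> r j \<le> q j + 1" for r
  proof -
    have "r i \<le> P"
      using r q(1) i by (metis Suc_eq_plus1 Suc_leI order_trans)
    then consider "r i = 0" | "r i = P" | "0 < r i" "r i < P"
      by linarith
    then show ?thesis
      using D_bound[OF i gV[OF r]] Deq[OF r] gV[OF r] P P' by cases (auto simp: lab_def)
  qed
  then show False
    using q(2) i by (metis (no_types, lifting))
qed

text \<open>Pulls the cover back along \<open>e\<close>. The i-th set only has to make the i-th
  coordinate inessential, so k + 1 \<le> m sets are assigned to distinct coordinates and the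
  remaining coordinates get empty sets.\<close>

corollary torus_map_not_covered:
  fixes Y :: "'y topology" and e :: "(nat \<Rightarrow> real) \<Rightarrow> 'y" and h :: "nat \<Rightarrow> real \<Rightarrow> 'y \<Rightarrow> complex"
  assumes e: "continuous_map euclidean Y e"
    and per: "\<And>\<theta> \<theta>'. (\<And>j. j < m \<Longrightarrow> cis (\<theta> j) = cis (\<theta>' j)) \<Longrightarrow> e \<theta> = e \<theta>'"
    and U: "\<And>i. i \<le> k \<Longrightarrow> openin Y (U i)"
    and cover: "topspace Y \<subseteq> (\<Union>i\<in>{0..k}. U i)"
    and km: "k < m"
    and cont: "\<And>i. i \<le> k \<Longrightarrow>
      continuous_map (prod_topology (top_of_set {0..1}) (subtopology Y (U i))) euclidean (\<lambda>(t, y). h i t y)"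
    and nz: "\<And>i t y. i \<le> k \<Longrightarrow> t \<in> {0..1} \<Longrightarrow> y \<in> U i \<Longrightarrow> h i t y \<noteq> 0"
    and ends: "\<And>i \<theta>. i \<le> k \<Longrightarrow> e \<theta> \<in> U i \<Longrightarrow> h i 1 (e \<theta>) = c i * cis (\<theta> i) * h i 0 (e \<theta>)"
  shows False
proof (rule torus_not_covered[where m = m and V = "\<lambda>i. if i \<le> k then {\<theta>. e \<theta> \<in> U i} else {}"
      and h = "\<lambda>i t \<theta>. h i t (e \<theta>)" and c = c], goal_cases)
  case (1 i)
  then show ?case
    using openin_continuous_map_preimage[OF e U] by auto
next
  case (2 \<theta>)
  have "e \<theta> \<in> topspace Y"
    using continuous_map_image_subset_topspace[OF e] by auto
  then obtain i where "i \<le> k" "e \<theta> \<in> U i"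
    using cover by auto
  then show ?case
    using km by (intro exI[of _ i]) auto
next
  case (3 i \<theta> \<theta>')
  then show ?case
    using per[of \<theta> \<theta>'] by (auto split: if_splits)
next
  case (4 i \<theta> \<theta>' t)
  then show ?case
    using per[of \<theta> \<theta>'] by auto
next
  case (5 i)
  show ?case
  proof (cases "i \<le> k")
    case True
    let ?V = "{\<theta>. e \<theta> \<in> U i}"
    have "continuous_map (top_of_set ?V) (subtopology Y (U i)) e"
      using e by (auto simp: continuous_map_in_subtopology continuous_map_from_subtopology)
    then have "continuous_map (top_of_set ({0..1::real} \<times> ?V)) (subtopology Y (U i)) (e \<circ> snd)"
      by (rule continuous_map_compose[rotated]) (auto intro!: continuous_on_snd continuous_on_id)
    moreover have "continuous_map (top_of_set ({0..1} \<times> ?V)) (top_of_set {0..1::real}) fst"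
      by (auto intro!: continuous_on_fst continuous_on_id)
    ultimately have "continuous_map (top_of_set ({0..1::real} \<times> ?V))
        (prod_topology (top_of_set {0..1}) (subtopology Y (U i))) (\<lambda>z. (fst z, e (snd z)))"
      unfolding continuous_map_pairwise o_def by simp
    from continuous_map_compose[OF this cont[OF True]] True show ?thesis
      by (simp add: o_def case_prod_beta)
  qed simp
next
  case (6 i \<theta> t)
  then show ?case
    using nz by (auto split: if_splits)
next
  case (7 i \<theta>)
  then show ?case
    using ends by (auto split: if_splits)
qed

section \<open>Topological complexity of right angled Artin complexes\<close>

text \<open>A point of the torus lies in exactly one cell, the one indexed by its coordinates
  different from 1.\<close>

lemma topspace_raag_complex:
  "topspace (raag_complex n E) =
     {x \<in> PiE {1..n} (\<lambda>_. sphere 0 1). clique {v \<in> {1..n}. x v \<noteq> 1} E}"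
proof -
  have torus: "topspace (torus n) = PiE {1..n} (\<lambda>_. sphere 0 1)"
    by (simp add: torus_def)
  have "(\<exists>J. J \<subseteq> {1..n} \<and> clique J E \<and> x \<in> torus_cell n J) \<longleftrightarrow>
      x \<in> topspace (torus n) \<and> clique {v \<in> {1..n}. x v \<noteq> 1} E" for x
  proof safe
    fix J assume J: "J \<subseteq> {1..n}" "clique J E" "x \<in> torus_cell n J"
    then have "{v \<in> {1..n}. x v \<noteq> 1} = J"
      by (auto simp: torus_cell_def)
    then show "clique {v \<in> {1..n}. x v \<noteq> 1} E" "x \<in> topspace (torus n)"
      using J by (auto simp: torus_cell_def)
  next
    assume "x \<in> topspace (torus n)" "clique {v \<in> {1..n}. x v \<noteq> 1} E"
    then show "\<exists>J. J \<subseteq> {1..n} \<and> clique J E \<and> x \<in> torus_cell n J"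
      by (intro exI[of _ "{v \<in> {1..n}. x v \<noteq> 1}"]) (auto simp: torus_cell_def)
  qed
  then show ?thesis
    unfolding raag_complex_def topspace_subtopology torus by auto
qed

lemma continuous_map_into_raag_complex:
  assumes "\<And>v. v \<in> {1..n} \<Longrightarrow> continuous_map Z euclidean (\<lambda>z. f z v)"
    and "\<And>z. z \<in> topspace Z \<Longrightarrow> f z \<in> topspace (raag_complex n E)"
  shows "continuous_map Z (raag_complex n E) f"
proof -
  have "continuous_map Z (torus n) f"
    unfolding torus_def continuous_map_componentwise
  proof (intro conjI ballI)
    show "f ` topspace Z \<subseteq> extensional {1..n}"
      using assms(2) by (auto simp: topspace_raag_complex PiE_def)
    show "continuous_map Z (top_of_set (sphere 0 1)) (\<lambda>z. f z v)" if "v \<in> {1..n}" for v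
      unfolding continuous_map_in_subtopology
      using assms(1)[OF that] assms(2) that by (auto simp: topspace_raag_complex PiE_def Pi_def)
  qed
  then show ?thesis
    using assms(2) by (auto simp: raag_complex_def continuous_map_in_subtopology)
qed

lemma continuous_map_raag_complex_coordinate:
  assumes "v \<in> {1..n}"
  shows "continuous_map (raag_complex n E) euclidean (\<lambda>x. x v)"
proof -
  have "continuous_map (raag_complex n E) (top_of_set (sphere 0 1)) (\<lambda>x. x v)"
    unfolding raag_complex_def torus_def
    by (intro continuous_map_from_subtopology continuous_map_product_projection assms)
  then show ?thesis
    by (rule continuous_map_into_fulltopology)
qed

lemma raag_complex_coordinate_nonzero:
  assumes "x \<in> topspace (raag_complex n E)" "v \<in> {1..n}"
  shows "x v \<noteq> 0" "norm (x v) = 1"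
proof -
  have "x v \<in> sphere 0 1"
    using assms by (auto simp: topspace_raag_complex)
  then show "norm (x v) = 1"
    by simp
  then show "x v \<noteq> 0"
    by force
qed

section \<open>Mapping spaces and the wedge of intervals\<close>

lemma continuous_map_eval_path:
  assumes \<sigma>: "continuous_map Z (compact_open_topology Y X) \<sigma>"
    and w: "continuous_map (top_of_set {0..1::real}) Y w"
  shows "continuous_map (prod_topology (top_of_set {0..1}) Z) X (\<lambda>(t, z). \<sigma> z (w t))"
proof -
  have \<sigma>X: "continuous_map Y X (\<sigma> z)" "\<sigma> z \<in> extensional (topspace Y)" if "z \<in> topspace Z" for z
    using continuous_map_image_subset_topspace[OF \<sigma>] that by auto
  have \<sigma>w: "continuous_map (top_of_set {0..1}) X (\<lambda>t. \<sigma> z (w t))" if "z \<in> topspace Z" for z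
    using continuous_map_compose[OF w \<sigma>X(1)[OF that]] by (simp add: o_def)
  show ?thesis
    unfolding continuous_map_def
  proof (intro conjI allI impI)
    show "(\<lambda>(t, z). \<sigma> z (w t)) \<in> topspace (prod_topology (top_of_set {0..1}) Z) \<rightarrow> topspace X"
      using continuous_map_image_subset_topspace[OF \<sigma>w] by fastforce
    fix W assume W: "openin X W"
    show "openin (prod_topology (top_of_set {0..1}) Z)
        {p \<in> topspace (prod_topology (top_of_set {0..1}) Z). (case p of (t, z) \<Rightarrow> \<sigma> z (w t)) \<in> W}"
      (is "openin ?P ?S")
    proof (subst openin_subopen, intro ballI)
      fix p assume "p \<in> ?S"
      then obtain t0 z0 where p: "p = (t0, z0)" "t0 \<in> {0..1}" "z0 \<in> topspace Z" "\<sigma> z0 (w t0) \<in> W"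
        by auto
      have "openin (top_of_set {0..1}) {t \<in> {0..1}. \<sigma> z0 (w t) \<in> W}"
        using openin_continuous_map_preimage[OF \<sigma>w[OF p(3)] W] by simp
      then obtain e where e: "0 < e" "ball t0 e \<inter> {0..1} \<subseteq> {t \<in> {0..1}. \<sigma> z0 (w t) \<in> W}"
        using p unfolding openin_contains_ball by blast
      define C where "C = {0..1} \<inter> cball t0 (e/2)"
      have "compact C"
        unfolding C_def by (intro compact_Int_closed) auto
      then have "compactin (top_of_set {0..1}) C"
        by (auto simp: C_def compactin_subtopology)
      then have C: "compactin Y (w ` C)"
        by (rule image_compactin[OF _ w])
      define N where "N = {0..1} \<inter> ball t0 (e/2)"
      define B where "B = {z \<in> topspace Z.
        \<sigma> z \<in> {f \<in> extensional (topspace Y). continuous_map Y X f \<and> f ` w ` C \<subseteq> W}}"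
      have "openin (compact_open_topology Y X)
          {f \<in> extensional (topspace Y). continuous_map Y X f \<and> f ` w ` C \<subseteq> W}"
        unfolding compact_open_topology_def by (rule topology_generated_by_Basis) (use C W in blast)
      then have B: "openin Z B"
        unfolding B_def by (rule openin_continuous_map_preimage[OF \<sigma>])
      have N: "openin (top_of_set {0..1}) N"
        unfolding N_def by (simp add: openin_open_Int)
      have "t0 \<in> N"
        using p e by (simp add: N_def)
      moreover have "z0 \<in> B"
      proof -
        have "\<sigma> z0 (w t) \<in> W" if "t \<in> C" for t
        proof -
          have "t \<in> ball t0 e \<inter> {0..1}"
            using that e by (auto simp: C_def)
          then show ?thesis
            using e by blast
        qed
        then show ?thesis
          using p \<sigma>X[OF p(3)] by (auto simp: B_def)
      qed
      moreover have "N \<times> B \<subseteq> ?S"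
        by (auto simp: N_def B_def C_def)
      ultimately show "\<exists>T. openin ?P T \<and> p \<in> T \<and> T \<subseteq> ?S"
        using N B p by (intro exI[of _ "N \<times> B"]) (auto simp: openin_prod_Times_iff)
    qed
  qed
qed

text \<open>Currying, by the tube lemma: an open set containing {z} \<times> C contains a product
  neighbourhood A \<times> B, so all points of \<open>A\<close> satisfy the same subbasic
  condition.\<close>

lemma continuous_map_into_compact_open:
  assumes H: "continuous_map (prod_topology Z Y) X (\<lambda>(z, y). H z y)"
  shows "continuous_map Z (compact_open_topology Y X) (\<lambda>z. restrict (H z) (topspace Y))"
proof -
  have Hz: "continuous_map Y X (restrict (H z) (topspace Y))" if "z \<in> topspace Z" for z
  proof -
    have "continuous_map Y (prod_topology Z Y) (\<lambda>y. (z, y))"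
      using that by (simp add: continuous_map_pairwise o_def)
    from continuous_map_compose[OF this H] show ?thesis
      by (rule continuous_map_eq) auto
  qed
  show ?thesis
    unfolding compact_open_topology_def
  proof (rule continuous_on_generated_topo)
    have "\<Union> {{f \<in> extensional (topspace Y). continuous_map Y X f \<and> f ` C \<subseteq> U} |C U.
             compactin Y C \<and> openin X U} = topspace (compact_open_topology Y X)"
      unfolding compact_open_topology_def by (rule topology_generated_by_topspace[symmetric])
    moreover have "(\<lambda>z. restrict (H z) (topspace Y)) ` topspace Z \<subseteq> topspace (compact_open_topology Y X)"
      unfolding topspace_compact_open_topology using Hz by blast
    ultimately show "(\<lambda>z. restrict (H z) (topspace Y)) ` topspace Z
        \<subseteq> \<Union> {{f \<in> extensional (topspace Y). continuous_map Y X f \<and> f ` C \<subseteq> U} |C U.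
             compactin Y C \<and> openin X U}"
      by (simp only:)
  next
    fix S assume "S \<in> {{f \<in> extensional (topspace Y). continuous_map Y X f \<and> f ` C \<subseteq> U} |C U.
             compactin Y C \<and> openin X U}"
    then obtain C U where S: "S = {f \<in> extensional (topspace Y). continuous_map Y X f \<and> f ` C \<subseteq> U}"
      and C: "compactin Y C" and U: "openin X U"
      by blast
    have CY: "C \<subseteq> topspace Y"
      using C by (rule compactin_subset_topspace)
    let ?W = "{p \<in> topspace (prod_topology Z Y). (case p of (z, y) \<Rightarrow> H z y) \<in> U}"
    have W: "openin (prod_topology Z Y) ?W"
      by (rule openin_continuous_map_preimage[OF H U])
    show "openin Z ((\<lambda>z. restrict (H z) (topspace Y)) -` S \<inter> topspace Z)" (is "openin Z ?P")
    proof (subst openin_subopen, intro ballI)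
      fix z assume z: "z \<in> ?P"
      then have "restrict (H z) (topspace Y) ` C \<subseteq> U" and zZ: "z \<in> topspace Z"
        unfolding S by blast+
      then have HU: "H z y \<in> U" if "y \<in> C" for y
        using CY that by (metis image_subset_iff restrict_apply subsetD)
      have zC: "{z} \<times> C \<subseteq> ?W"
      proof
        fix p assume "p \<in> {z} \<times> C"
        then obtain y where y: "p = (z, y)" "y \<in> C"
          by blast
        moreover have "y \<in> topspace Y"
          using CY y(2) by blast
        ultimately show "p \<in> ?W"
          using zZ HU[OF y(2)] by simp
      qed
      have zz: "compactin Z {z}"
        using zZ by simp
      obtain A B where AB: "openin Z A" "openin Y B" "{z} \<subseteq> A" "C \<subseteq> B" "A \<times> B \<subseteq> ?W"
        by (rule Wallace_theorem_prod_topology[OF zz C W zC])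
      have "A \<subseteq> ?P"
      proof
        fix a assume a: "a \<in> A"
        then have aZ: "a \<in> topspace Z"
          using AB(1) openin_subset by blast
        have "H a y \<in> U" if "y \<in> C" for y
        proof -
          have "(a, y) \<in> ?W"
            using AB(4,5) a that by blast
          then show ?thesis
            by simp
        qed
        then have "restrict (H a) (topspace Y) ` C \<subseteq> U"
          using CY by (auto simp: subset_iff)
        then show "a \<in> ?P"
          unfolding S using aZ Hz[OF aZ] by blast
      qed
      then show "\<exists>T. openin Z T \<and> z \<in> T \<and> T \<subseteq> ?P"
        using AB by blast
    qed
  qed
qed

lemma continuous_map_wedge_arm:
  assumes "a \<in> {1..s}"
  shows "continuous_map (top_of_set {0..1}) (interval_wedge s) (\<lambda>t. if t = 0 then (0, 0) else (a, t))"
proof -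
  have "continuous_map (top_of_set {0..1::real}) (sum_topology (\<lambda>_. top_of_set {0..1}) {1..s}) (\<lambda>t. (a, t))"
    using continuous_map_component_injection[of a "{1..s}" "\<lambda>_. top_of_set {0..1::real}"] assms by simp
  from continuous_map_compose[OF this quotient_imp_continuous_map[OF quotient_map_quotient_topology
        [of _ "\<lambda>(i, t). if t = 0 then (0, 0) else (i, t)"]]]
  show ?thesis
    unfolding interval_wedge_def by (simp add: o_def)
qed

text \<open>This is the height along arm \<open>a\<close>, with all other arms collapsed. It
  vanishes at every point that is glued, so continuity can be checked on the disjoint union.\<close>

lemma continuous_map_wedge_coordinate:
  assumes "a \<ge> 1"
  shows "continuous_map (interval_wedge s) euclideanreal (\<lambda>(j, t). if j = a then t else 0)"
  unfolding interval_wedge_def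
proof (subst continuous_compose_quotient_map_eq[OF quotient_map_quotient_topology, symmetric])
  let ?Q = "sum_topology (\<lambda>_. top_of_set {0..1::real}) {1..s}"
  have "continuous_map ?Q euclideanreal (\<lambda>(j, t). if j = a then t else 0)"
    unfolding continuous_map_def
  proof (intro conjI allI impI)
    fix W :: "real set" assume "openin euclidean W"
    then have "open W" by simp
    have "openin (top_of_set {0..1}) {t. t \<in> {0..1} \<and> (if j = a then t else 0) \<in> W}" for j
    proof (cases "j = a")
      case True
      have "{t. t \<in> {0..1} \<and> (if j = a then t else 0) \<in> W} = {0..1} \<inter> W"
        using True by auto
      then show ?thesis
        using \<open>open W\<close> by (simp add: openin_open_Int)
    next
      case False
      then have "{t. t \<in> {0..1} \<and> (if j = a then t else 0) \<in> W} = (if 0 \<in> W then {0..1} else {})"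
        by auto
      then show ?thesis
        using openin_subtopology_self by auto
    qed
    then show "openin ?Q {p \<in> topspace ?Q. (case p of (j, t) \<Rightarrow> if j = a then t else 0) \<in> W}"
      by (auto simp: openin_sum_topology)
  qed simp
  then show "continuous_map ?Q euclideanreal
      ((\<lambda>(j, t). if j = a then t else 0) \<circ> (\<lambda>(i, t). if t = 0 then (0, 0) else (i, t)))"
    by (rule continuous_map_eq) (use assms in auto)
qed

lemma enat_le_open_cover_number:
  fixes X :: "'a topology"
  assumes "\<And>k (U :: nat \<Rightarrow> 'a set). (\<And>i. i \<le> k \<Longrightarrow> openin X (U i)) \<Longrightarrow> (\<And>i. i \<le> k \<Longrightarrow> P (U i)) \<Longrightarrow>
              topspace X \<subseteq> (\<Union>i\<in>{0..k}. U i) \<Longrightarrow> k < m \<Longrightarrow> False"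
  shows "enat m \<le> open_cover_number X P"
  unfolding open_cover_number_def
proof (rule Inf_greatest, clarify)
  fix k and U :: "nat \<Rightarrow> 'a set"
  assume "\<forall>i\<in>{0..k}. openin X (U i) \<and> P (U i)" "topspace X \<subseteq> (\<Union>i\<in>{0..k}. U i)"
  then have "\<not> k < m"
    using assms[of k U] by auto
  then show "enat m \<le> enat k"
    by simp
qed

lemma open_cover_number_le_enat:
  assumes "\<And>i. i \<le> k \<Longrightarrow> openin X (U i)" "\<And>i. i \<le> k \<Longrightarrow> P (U i)"
    "topspace X \<subseteq> (\<Union>i\<in>{0..k}. U i)"
  shows "open_cover_number X P \<le> enat k"
proof -
  have "\<forall>i\<in>{0..k}. openin X (U i) \<and> P (U i)"
    using assms(1,2) by simp
  then show ?thesis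
    unfolding open_cover_number_def using assms(3) by (intro Inf_lower) blast
qed

lemma continuous_map_complex_divide:
  fixes f g :: "'a \<Rightarrow> complex"
  assumes "continuous_map X euclidean f" "continuous_map X euclidean g"
    and "\<And>x. x \<in> topspace X \<Longrightarrow> g x \<noteq> 0"
  shows "continuous_map X euclidean (\<lambda>x. f x / g x)"
  using assms unfolding continuous_map_atin by (auto intro!: tendsto_divide)

section \<open>Lower bounds from tori of cliques\<close>

definition subtorus :: "nat \<Rightarrow> nat set \<Rightarrow> (nat \<Rightarrow> real) \<Rightarrow> nat \<Rightarrow> complex" where
  "subtorus n K \<phi> = (\<lambda>v\<in>{1..n}. if v \<in> K then cis (\<phi> v) else 1)"

lemma subtorus_in_raag_complex:
  assumes "clique K E"
  shows "subtorus n K \<phi> \<in> topspace (raag_complex n E)"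
proof -
  have "{v \<in> {1..n}. subtorus n K \<phi> v \<noteq> 1} \<subseteq> K"
    by (auto simp: subtorus_def split: if_splits)
  then have "clique {v \<in> {1..n}. subtorus n K \<phi> v \<noteq> 1} E"
    using assms unfolding clique_def by blast
  then show ?thesis
    by (auto simp: topspace_raag_complex subtorus_def)
qed

lemma continuous_map_subtorus:
  assumes "clique K E"
  shows "continuous_map euclidean (raag_complex n E) (\<lambda>\<theta>. subtorus n K (\<lambda>v. \<theta> (idx v :: nat)))"
proof (rule continuous_map_into_raag_complex)
  fix v assume "v \<in> {1..n}"
  then show "continuous_map euclidean euclidean (\<lambda>\<theta>. subtorus n K (\<lambda>v. \<theta> (idx v)) v)"
    by (cases "v \<in> K") (auto simp: subtorus_def cis_conv_exp intro!: continuous_intros)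
qed (use assms subtorus_in_raag_complex in auto)

lemma subtorus_cong:
  assumes "\<And>v. v \<in> K \<Longrightarrow> cis (\<phi> v) = cis (\<psi> v)"
  shows "subtorus n K \<phi> = subtorus n K \<psi>"
  unfolding subtorus_def by (rule restrict_ext) (simp add: assms)

lemma LS_category_raag_complex_ge:
  assumes K: "K \<subseteq> {1..n}" "clique K E"
  shows "enat (card K) \<le> LS_category (raag_complex n E)"
  unfolding LS_category_def
proof (rule enat_le_open_cover_number)
  let ?X = "raag_complex n E"
  have finK: "finite K"
    using K finite_subset by blast
  fix k and U :: "nat \<Rightarrow> (nat \<Rightarrow> complex) set"
  assume op: "\<And>i. i \<le> k \<Longrightarrow> openin ?X (U i)" and cover: "topspace ?X \<subseteq> (\<Union>i\<in>{0..k}. U i)"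
    and km: "k < card K"
    and nullh: "\<And>i. i \<le> k \<Longrightarrow> \<exists>a. homotopic_with (\<lambda>_. True) (subtopology ?X (U i)) ?X (\<lambda>x. x) (\<lambda>_. a)"
  obtain idx where idx: "bij_betw idx K {..<card K}"
    using ex_bij_betw_finite_nat[OF finK] by (auto simp: atLeast0LessThan)
  define vtx where "vtx = inv_into K idx"
  have vtx: "vtx i \<in> K" "idx (vtx i) = i" if "i < card K" for i
    using idx that bij_betw_inv_into_right[OF idx] bij_betw_apply[OF bij_betw_inv_into[OF idx]]
    by (auto simp: vtx_def)
  have "\<exists>H a. continuous_map (prod_topology (top_of_set {0..1::real}) (subtopology ?X (U i))) ?X H \<and>
      (\<forall>x. H (0, x) = x) \<and> (\<forall>x. H (1, x) = a)" if "i \<le> k" for i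
    using nullh[OF that] unfolding homotopic_with_def by blast
  then obtain H a where
      H: "\<And>i. i \<le> k \<Longrightarrow> continuous_map (prod_topology (top_of_set {0..1}) (subtopology ?X (U i))) ?X (H i)"
      "\<And>i x. i \<le> k \<Longrightarrow> H i (0, x) = x" "\<And>i x. i \<le> k \<Longrightarrow> H i (1::real, x) = a i"
    by metis
  have Hin: "H i (t, x) \<in> topspace ?X" if "i \<le> k" "t \<in> {0..1}" "x \<in> U i" for i t x
  proof -
    have "x \<in> topspace ?X"
      using op[OF that(1)] that(3) openin_subset by blast
    then show ?thesis
      using continuous_map_image_subset_topspace[OF H(1)[OF that(1)]] that by fastforce
  qed
  show False
  \<comment> \<open>The null homotopy is run backwards, from the constant \<open>a i\<close> at time
    0 to the identity at time 1. The ratio of the end values at the vertex \<open>vtx i\<close> is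
    cis(\<theta> i) / \<open>a i (vtx i)\<close>, which dictates \<open>c\<close>.\<close>
  proof (rule torus_map_not_covered[where Y = ?X and U = U and m = "card K" and k = k
        and e = "\<lambda>\<theta>. subtorus n K (\<lambda>v. \<theta> (idx v))" and h = "\<lambda>i t x. H i (1 - t, x) (vtx i)"
        and c = "\<lambda>i. 1 / a i (vtx i)"])
    show "continuous_map euclidean ?X (\<lambda>\<theta>. subtorus n K (\<lambda>v. \<theta> (idx v)))"
      by (rule continuous_map_subtorus[OF K(2)])
    show "subtorus n K (\<lambda>v. \<theta> (idx v)) = subtorus n K (\<lambda>v. \<theta>' (idx v))"
      if "\<And>j. j < card K \<Longrightarrow> cis (\<theta> j) = cis (\<theta>' j)" for \<theta> \<theta>'
      by (rule subtorus_cong) (use that idx bij_betw_apply in fastforce)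
    fix i assume i: "i \<le> k"
    then have v: "vtx i \<in> K" "idx (vtx i) = i" "vtx i \<in> {1..n}"
      using vtx[of i] km subsetD[OF K(1), of "vtx i"] by auto
    let ?D = "prod_topology (top_of_set {0..1::real}) (subtopology ?X (U i))"
    have "continuous_map ?D (top_of_set {0..1::real}) (\<lambda>z. 1 - fst z)"
    proof -
      have "continuous_map (top_of_set {0..1}) (top_of_set {0..1::real}) (\<lambda>t. 1 - t)"
        by (auto intro!: continuous_intros)
      from continuous_map_compose[OF continuous_map_fst[of _ "subtopology ?X (U i)"] this] show ?thesis
        by (simp add: o_def)
    qed
    then have "continuous_map ?D ?D (\<lambda>z. (1 - fst z, snd z))"
      by (simp add: continuous_map_pairwise o_def continuous_map_snd)
    from continuous_map_compose[OF continuous_map_compose[OF this H(1)[OF i]]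
        continuous_map_raag_complex_coordinate[OF v(3)]]
    show "continuous_map ?D euclidean (\<lambda>(t, x). H i (1 - t, x) (vtx i))"
      by (simp add: o_def case_prod_unfold)
    show nz: "H i (1 - t, x) (vtx i) \<noteq> 0" if "t \<in> {0..1}" "x \<in> U i" for t x
      by (rule raag_complex_coordinate_nonzero[OF Hin[OF i]]) (use that v in auto)
    show "H i (1 - 1, subtorus n K (\<lambda>v. \<theta> (idx v))) (vtx i) =
        1 / a i (vtx i) * cis (\<theta> i) * H i (1 - 0, subtorus n K (\<lambda>v. \<theta> (idx v))) (vtx i)"
      if "subtorus n K (\<lambda>v. \<theta> (idx v)) \<in> U i" for \<theta>
      using nz[of 0, OF _ that] H(2,3)[OF i] v by (simp add: subtorus_def)
  qed (use op cover km in auto)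
qed

text \<open>
  The torus is the product over \<open>a\<close> of the tori of the cliques \<open>K a\<close>. Along the \<open>a\<close>-th arm of the
  wedge a section moves the base point to the \<open>a\<close>-th coordinate; comparing with an arm \<open>b\<close> whose
  clique avoids \<open>v\<close> makes the circle coordinate \<open>(a, v)\<close> inessential.
\<close>

lemma higher_TC_raag_complex_ge:
  assumes s: "s \<noteq> 1"
    and K: "\<And>a. a \<in> {1..s} \<Longrightarrow> K a \<subseteq> {1..n}" "\<And>a. a \<in> {1..s} \<Longrightarrow> clique (K a) E"
    and disj: "\<And>a. a \<in> {1..s} \<Longrightarrow> \<exists>b\<in>{1..s}. K a \<inter> K b = {}"
  shows "enat (\<Sum>a=1..s. card (K a)) \<le> higher_TC s (raag_complex n E)"
proof -
  let ?X = "raag_complex n E"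
  let ?Y = "product_topology (\<lambda>_. ?X) {1..s}"
  define I where "I = Sigma {1..s} K"
  have finK: "finite (K a)" if "a \<in> {1..s}" for a
    using K(1)[OF that] finite_subset by blast
  then have finI: "finite I" and cardI: "card I = (\<Sum>a=1..s. card (K a))"
    by (auto simp: I_def)
  have "enat (card I) \<le> open_cover_number ?Y
        (\<lambda>U. \<exists>\<sigma>. continuous_map (subtopology ?Y U) (compact_open_topology (interval_wedge s) ?X) \<sigma> \<and>
                 (\<forall>x\<in>U. endpoint_map s (\<sigma> x) = x))"
  proof (rule enat_le_open_cover_number)
    fix k and U :: "nat \<Rightarrow> (nat \<Rightarrow> nat \<Rightarrow> complex) set"
    assume op: "\<And>i. i \<le> k \<Longrightarrow> openin ?Y (U i)" and cover: "topspace ?Y \<subseteq> (\<Union>i\<in>{0..k}. U i)"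
      and km: "k < card I"
      and sec: "\<And>i. i \<le> k \<Longrightarrow> \<exists>\<sigma>. continuous_map (subtopology ?Y (U i))
          (compact_open_topology (interval_wedge s) ?X) \<sigma> \<and> (\<forall>x\<in>U i. endpoint_map s (\<sigma> x) = x)"
    obtain idx where idx: "bij_betw idx I {..<card I}"
      using ex_bij_betw_finite_nat[OF finI] by (auto simp: atLeast0LessThan)
    obtain \<sigma> where \<sigma>: "\<And>i. i \<le> k \<Longrightarrow> continuous_map (subtopology ?Y (U i))
          (compact_open_topology (interval_wedge s) ?X) (\<sigma> i)"
        "\<And>i x. i \<le> k \<Longrightarrow> x \<in> U i \<Longrightarrow> endpoint_map s (\<sigma> i x) = x"
      using sec by metis
    obtain opp where opp: "\<And>a. a \<in> {1..s} \<Longrightarrow> opp a \<in> {1..s} \<and> K a \<inter> K (opp a) = {}"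
      using disj by metis
    define arm where "arm = (\<lambda>i. fst (inv_into I idx i))"
    define vtx where "vtx = (\<lambda>i. snd (inv_into I idx i))"
    have coord: "arm i \<in> {1..s}" "vtx i \<in> K (arm i)" "idx (arm i, vtx i) = i" if "i < card I" for i
    proof -
      have "inv_into I idx i \<in> I" "idx (inv_into I idx i) = i"
        using that bij_betw_inv_into_right[OF idx] bij_betw_apply[OF bij_betw_inv_into[OF idx]] by auto
      then show "arm i \<in> {1..s}" "vtx i \<in> K (arm i)" "idx (arm i, vtx i) = i"
        by (auto simp: I_def arm_def vtx_def)
    qed
    define w :: "nat \<Rightarrow> real \<Rightarrow> nat \<times> real" where "w = (\<lambda>a t. if t = 0 then (0, 0) else (a, t))"
    define e where "e = (\<lambda>\<theta>. \<lambda>a\<in>{1..s}. subtorus n (K a) (\<lambda>v. \<theta> (idx (a, v))))"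
    show False
    \<comment> \<open>The comparison is a quotient of circle coordinates: at time 0 both arms are at
      the common base point and it is 1, at time 1 it is cis(\<theta> i) / 1. Hence \<open>c\<close>
      is 1 and no control of the base point is required.\<close>
    proof (rule torus_map_not_covered[where Y = ?Y and U = U and m = "card I" and k = k and e = e
          and h = "\<lambda>i t x. \<sigma> i x (w (arm i) t) (vtx i) / \<sigma> i x (w (opp (arm i)) t) (vtx i)"
          and c = "\<lambda>_. 1"])
      show "continuous_map euclidean ?Y e"
        unfolding continuous_map_componentwise
        by (auto simp: e_def intro!: continuous_map_subtorus K)
      show "e \<theta> = e \<theta>'" if "\<And>j. j < card I \<Longrightarrow> cis (\<theta> j) = cis (\<theta>' j)" for \<theta> \<theta>'
        unfolding e_def
      proof (intro restrict_ext subtorus_cong)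
        fix a v assume "a \<in> {1..s}" "v \<in> K a"
        then have "idx (a, v) < card I"
          using bij_betw_apply[OF idx, of "(a, v)"] by (simp add: I_def)
        then show "cis (\<theta> (idx (a, v))) = cis (\<theta>' (idx (a, v)))"
          by (rule that)
      qed
      fix i assume i: "i \<le> k"
      then have il: "i < card I"
        using km by simp
      let ?a = "arm i" and ?b = "opp (arm i)" and ?v = "vtx i"
      have a: "?a \<in> {1..s}" and b: "?b \<in> {1..s}" and va: "?v \<in> K ?a" and vb: "?v \<notin> K ?b"
        and v: "?v \<in> {1..n}"
        using coord[OF il] opp[of ?a] K(1)[of ?a] by auto
      let ?D = "prod_topology (top_of_set {0..1::real}) (subtopology ?Y (U i))"
      have cont: "continuous_map ?D ?X (\<lambda>(t, x). \<sigma> i x (w a t))" if "a \<in> {1..s}" for a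
        unfolding w_def by (rule continuous_map_eval_path[OF \<sigma>(1)[OF i] continuous_map_wedge_arm[OF that]])
      have cont': "continuous_map ?D euclidean (\<lambda>z. \<sigma> i (snd z) (w a (fst z)) ?v)" if "a \<in> {1..s}" for a
        using continuous_map_compose[OF cont[OF that] continuous_map_raag_complex_coordinate[OF v]]
        by (simp add: o_def case_prod_beta)
      have nz: "\<sigma> i x (w a t) ?v \<noteq> 0" if "a \<in> {1..s}" "t \<in> {0..1}" "x \<in> U i" for a t x
      proof -
        have "x \<in> topspace ?Y"
          using op[OF i] that(3) openin_subset by blast
        then have "\<sigma> i x (w a t) \<in> topspace ?X"
          using continuous_map_image_subset_topspace[OF cont[OF that(1)]] that by fastforce
        then show ?thesis
          by (rule raag_complex_coordinate_nonzero) (rule v)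
      qed
      show "continuous_map ?D euclidean (\<lambda>(t, x). \<sigma> i x (w ?a t) ?v / \<sigma> i x (w ?b t) ?v)"
        unfolding case_prod_beta
        by (intro continuous_map_complex_divide cont' a b) (use nz[OF b] in auto)
      show "\<sigma> i x (w ?a t) ?v / \<sigma> i x (w ?b t) ?v \<noteq> 0" if "t \<in> {0..1}" "x \<in> U i" for t x
        using nz[OF a that] nz[OF b that] by simp
      show "\<sigma> i (e \<theta>) (w ?a 1) ?v / \<sigma> i (e \<theta>) (w ?b 1) ?v =
          1 * cis (\<theta> i) * (\<sigma> i (e \<theta>) (w ?a 0) ?v / \<sigma> i (e \<theta>) (w ?b 0) ?v)"
        if \<theta>: "e \<theta> \<in> U i" for \<theta>
      proof -
        have end_eq: "\<sigma> i (e \<theta>) (w a 1) = e \<theta> a" if "a \<in> {1..s}" for a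
          using fun_cong[OF \<sigma>(2)[OF i \<theta>], of a] that by (simp add: endpoint_map_def w_def)
        have "\<sigma> i (e \<theta>) (w ?b 0) ?v \<noteq> 0"
          by (rule nz[OF b _ \<theta>]) simp
        moreover have "w ?a 0 = w ?b 0"
          by (simp add: w_def)
        moreover have "e \<theta> ?a ?v = cis (\<theta> i)" "e \<theta> ?b ?v = 1"
          using a b va vb v coord(3)[OF il] by (auto simp: e_def subtorus_def)
        ultimately show ?thesis
          using end_eq[OF a] end_eq[OF b] by simp
      qed
    qed (use op cover km in auto)
  qed
  then show ?thesis
    using s cardI by (simp add: higher_TC_def)
qed

section \<open>Upper bounds from continuous arguments\<close>

lemma norm_1_Arg:
  fixes z :: complex
  assumes "norm z = 1"
  shows "cis (Arg z) = z" "cis (Arg2pi z) = z"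
proof -
  have "z \<noteq> 0"
    using assms by force
  then show "cis (Arg z) = z"
    using assms by (simp add: cis_Arg sgn_eq)
  show "cis (Arg2pi z) = z"
    using Arg2pi_eq[of z] assms by (simp add: cis_conv_exp)
qed

lemma norm_1_Re:
  fixes z :: complex
  assumes "norm z = 1"
  shows "Re z < 1 \<longleftrightarrow> z \<noteq> 1" "Re z \<le> 1"
    and "z \<in> \<real>\<^sub>\<ge>\<^sub>0 \<Longrightarrow> z = 1" "z \<in> \<real>\<^sub>\<le>\<^sub>0 \<Longrightarrow> Re z = -1"
proof -
  have sq: "(Re z)\<^sup>2 + (Im z)\<^sup>2 = 1"
    using assms by (simp add: cmod_def)
  show le: "Re z \<le> 1"
    using complex_Re_le_cmod[of z] assms by simp
  have "Re z = 1 \<longleftrightarrow> z = 1"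
    using sq by (auto simp: complex_eq_iff)
  then show "Re z < 1 \<longleftrightarrow> z \<noteq> 1"
    using le by auto
  show "z = 1" if "z \<in> \<real>\<^sub>\<ge>\<^sub>0"
    using that assms by (auto simp: nonneg_Reals_def)
  show "Re z = -1" if "z \<in> \<real>\<^sub>\<le>\<^sub>0"
    using that assms by (auto simp: nonpos_Reals_def)
qed

text \<open>
  The \<open>d\<close>-th set is where the \<open>d\<close> coordinates farthest from \<open>1\<close> are determined without ties.
  On it these coordinates are different from \<open>1\<close> and the others are different from \<open>-1\<close>, so that
  all of them have continuous arguments.
\<close>

lemma circle_coordinates_cover:
  fixes Z :: "'z topology" and \<xi> :: "'i \<Rightarrow> 'z \<Rightarrow> complex"
  assumes fin: "finite I"
    and cont: "\<And>i. i \<in> I \<Longrightarrow> continuous_map Z euclidean (\<xi> i)"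
    and nrm: "\<And>i x. i \<in> I \<Longrightarrow> x \<in> topspace Z \<Longrightarrow> norm (\<xi> i x) = 1"
    and card: "\<And>x. x \<in> topspace Z \<Longrightarrow> card {i \<in> I. \<xi> i x \<noteq> 1} \<le> D"
  obtains U :: "nat \<Rightarrow> 'z set" and \<theta> :: "nat \<Rightarrow> 'i \<Rightarrow> 'z \<Rightarrow> real"
  where "\<forall>d. openin Z (U d)" "topspace Z \<subseteq> (\<Union>d\<in>{0..D}. U d)"
    and "\<forall>d. \<forall>i\<in>I. continuous_map (subtopology Z (U d)) euclideanreal (\<theta> d i)"
    and "\<forall>d. \<forall>i\<in>I. \<forall>x\<in>U d. cis (\<theta> d i x) = \<xi> i x"
    and "\<forall>d. \<forall>i\<in>I. \<forall>x\<in>U d. \<xi> i x = 1 \<longrightarrow> \<theta> d i x = 0"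
proof -
  \<comment> \<open>On the unit circle 1 - Re increases with the distance from 1, is 0 only at 1 and
    reaches 2 only at -1.\<close>
  define \<tau> where "\<tau> = (\<lambda>i x. 1 - Re (\<xi> i x))"
  \<comment> \<open>The first two conditions decide the cases J = {} and J = I, where the comparison
    between inside and outside is vacuous.\<close>
  define cell where "cell = (\<lambda>J. {x \<in> topspace Z.
      (\<forall>i\<in>J. 0 < \<tau> i x) \<and> (\<forall>j\<in>I - J. \<tau> j x < 2) \<and> (\<forall>i\<in>J. \<forall>j\<in>I - J. \<tau> j x < \<tau> i x)})"
  define U where "U = (\<lambda>d. \<Union>J\<in>{J. J \<subseteq> I \<and> card J = d}. cell J)"
  \<comment> \<open>The cut of \<open>Arg2pi\<close> is at the positive reals, avoided by
    coordinates in J; that of \<open>Arg\<close> is at the negative reals, avoided by the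
    others.\<close>
  define f where "f = (\<lambda>J i x. if i \<in> J then Arg2pi (\<xi> i x) else Arg (\<xi> i x))"
  \<comment> \<open>Cells of equal cardinality are disjoint by \<open>cell_unique\<close>, so
    \<open>SOME\<close> picks the only candidate and the branches can be pasted.\<close>
  define \<theta> where "\<theta> = (\<lambda>d i x. f (SOME J. J \<subseteq> I \<and> card J = d \<and> x \<in> cell J) i x)"
  have \<tau>_cont: "continuous_map Z euclideanreal (\<tau> i)" if "i \<in> I" for i
  proof -
    have "continuous_map euclidean euclideanreal (\<lambda>z::complex. 1 - Re z)"
      by (auto intro!: continuous_intros)
    from continuous_map_compose[OF cont[OF that] this] show ?thesis
      by (simp add: o_def \<tau>_def)
  qed
  have op_less: "openin Z {x \<in> topspace Z. g x < h x}"
    if "continuous_map Z euclideanreal g" "continuous_map Z euclideanreal h" for g h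
  proof -
    have "openin Z {x \<in> topspace Z. h x - g x \<in> {0<..}}"
      by (rule openin_continuous_map_preimage[OF continuous_map_diff[OF that(2,1)]]) auto
    then show ?thesis
      by simp
  qed
  have op_ball: "openin Z {x \<in> topspace Z. \<forall>i\<in>A. P i x}"
    if "A \<subseteq> I" "\<And>i. i \<in> A \<Longrightarrow> openin Z {x \<in> topspace Z. P i x}" for A P
  proof -
    have "openin Z (\<Inter>i\<in>A. {x \<in> topspace Z. P i x}) \<or> A = {}"
      using that finite_subset[OF that(1) fin] by (auto intro!: openin_Inter)
    moreover have "{x \<in> topspace Z. \<forall>i\<in>A. P i x} = (\<Inter>i\<in>A. {x \<in> topspace Z. P i x})" if "A \<noteq> {}"
      using that by auto
    ultimately show ?thesis
      by (cases "A = {}") auto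
  qed
  have cell_open: "openin Z (cell J)" if J: "J \<subseteq> I" for J
  proof -
    have "openin Z ({x \<in> topspace Z. \<forall>i\<in>J. 0 < \<tau> i x} \<inter> {x \<in> topspace Z. \<forall>j\<in>I - J. \<tau> j x < 2} \<inter>
        {x \<in> topspace Z. \<forall>i\<in>J. \<forall>j\<in>I - J. \<tau> j x < \<tau> i x})"
      using J by (intro openin_Int op_ball op_less \<tau>_cont) auto
    then show ?thesis
      by (rule back_subst[where P = "openin Z"]) (auto simp: cell_def)
  qed
  have cell_unique: "J = J'"
    if "J \<subseteq> I" "J' \<subseteq> I" "card J = card J'" "x \<in> cell J" "x \<in> cell J'" for J J' x
  proof (rule ccontr)
    assume "J \<noteq> J'"
    have finJ: "finite J" "finite J'"
      using that fin finite_subset by auto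
    have "\<not> J \<subseteq> J'" "\<not> J' \<subseteq> J"
      using card_subset_eq[OF finJ(2)] card_subset_eq[OF finJ(1)] that(3) \<open>J \<noteq> J'\<close> by auto
    then obtain i j where "i \<in> J" "i \<notin> J'" "j \<in> J'" "j \<notin> J"
      by blast
    then have "\<tau> j x < \<tau> i x" "\<tau> i x < \<tau> j x"
      using that by (auto simp: cell_def)
    then show False
      by simp
  qed
  have \<theta>_eq: "\<theta> d i x = f J i x" if "J \<subseteq> I" "card J = d" "x \<in> cell J" for d i x J
  proof -
    have "(SOME J. J \<subseteq> I \<and> card J = d \<and> x \<in> cell J) = J"
      by (rule some_equality) (use that cell_unique in blast)+
    then show ?thesis
      by (simp add: \<theta>_def)
  qed
  have f_cont: "continuous_map (subtopology Z (cell J)) euclideanreal (f J i)" if J: "J \<subseteq> I" and i: "i \<in> I" for J i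
  proof (cases "i \<in> J")
    case True
    have "\<xi> i x \<notin> \<real>\<^sub>\<ge>\<^sub>0" if "x \<in> cell J" for x
      using that True nrm[OF i, of x] norm_1_Re[of "\<xi> i x"] by (auto simp: cell_def \<tau>_def)
    then have "continuous_map (subtopology Z (cell J)) (top_of_set (- \<real>\<^sub>\<ge>\<^sub>0)) (\<xi> i)"
      using cont[OF i] by (auto simp: continuous_map_in_subtopology continuous_map_from_subtopology)
    moreover have "continuous_map (top_of_set (- \<real>\<^sub>\<ge>\<^sub>0)) euclideanreal Arg2pi"
      using continuous_at_Arg2pi by (auto intro!: continuous_at_imp_continuous_on)
    ultimately have "continuous_map (subtopology Z (cell J)) euclideanreal (Arg2pi \<circ> \<xi> i)"
      by (rule continuous_map_compose)
    then show ?thesis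
      using True by (simp add: f_def o_def)
  next
    case False
    have "\<xi> i x \<notin> \<real>\<^sub>\<le>\<^sub>0" if "x \<in> cell J" for x
    proof -
      have "- 1 < Re (\<xi> i x)" "x \<in> topspace Z"
        using that False i by (auto simp: cell_def \<tau>_def)
      then show ?thesis
        using norm_1_Re(4)[OF nrm[OF i, of x]] by auto
    qed
    then have "continuous_map (subtopology Z (cell J)) (top_of_set (- \<real>\<^sub>\<le>\<^sub>0)) (\<xi> i)"
      using cont[OF i] by (auto simp: continuous_map_in_subtopology continuous_map_from_subtopology)
    moreover have "continuous_map (top_of_set (- \<real>\<^sub>\<le>\<^sub>0)) euclideanreal Arg"
      using continuous_on_Arg by simp
    ultimately have "continuous_map (subtopology Z (cell J)) euclideanreal (Arg \<circ> \<xi> i)"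
      by (rule continuous_map_compose)
    then show ?thesis
      using False by (simp add: f_def o_def)
  qed
  have in_U: "\<exists>J. J \<subseteq> I \<and> card J = d \<and> x \<in> cell J" if "x \<in> U d" for d x
    using that by (auto simp: U_def)
  show ?thesis
  proof (rule that[of U \<theta>]; (intro allI ballI impI)?)
    show "openin Z (U d)" for d
      unfolding U_def using cell_open by (intro openin_Union) auto
    show "topspace Z \<subseteq> (\<Union>d\<in>{0..D}. U d)"
    proof
      fix x assume x: "x \<in> topspace Z"
      \<comment> \<open>Every point lies in the cell of its coordinates different from 1, so the
        hypothesis \<open>card\<close> bounds the indices d required.\<close>
      let ?J = "{i \<in> I. \<xi> i x \<noteq> 1}"
      have pos: "\<tau> i x > 0" if "i \<in> ?J" for i
        using that norm_1_Re[OF nrm[OF _ x]] by (auto simp: \<tau>_def)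
      have zero: "\<tau> i x = 0" if "i \<in> I - ?J" for i
        using that by (auto simp: \<tau>_def)
      have "x \<in> cell ?J"
        unfolding cell_def
      proof (intro CollectI conjI ballI x)
        show "0 < \<tau> i x" if "i \<in> ?J" for i
          by (rule pos[OF that])
        show "\<tau> j x < 2" if "j \<in> I - ?J" for j
          unfolding zero[OF that] by simp
        show "\<tau> j x < \<tau> i x" if "i \<in> ?J" "j \<in> I - ?J" for i j
          unfolding zero[OF that(2)] by (rule pos[OF that(1)])
      qed
      moreover have "?J \<in> {J. J \<subseteq> I \<and> card J = card ?J}"
        by auto
      ultimately have "x \<in> U (card ?J)"
        unfolding U_def by (rule UN_I[rotated])
      then show "x \<in> (\<Union>d\<in>{0..D}. U d)"
        using card[OF x] by (intro UN_I[of "card ?J"]) auto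
    qed
    show "continuous_map (subtopology Z (U d)) euclideanreal (\<theta> d i)" if i: "i \<in> I" for d i
    proof (rule pasting_lemma[where I = "{J. J \<subseteq> I \<and> card J = d}" and T = cell and f = "\<lambda>J. f J i"])
      fix J assume J: "J \<in> {J. J \<subseteq> I \<and> card J = d}"
      then have sub: "cell J \<subseteq> U d"
        by (auto simp: U_def)
      show "openin (subtopology Z (U d)) (cell J)"
        using cell_open[of J] J sub by (auto simp: openin_subtopology)
      show "continuous_map (subtopology (subtopology Z (U d)) (cell J)) euclideanreal (f J i)"
        using f_cont[of J i] J i sub by (simp add: subtopology_subtopology Int_absorb1)
    next
      fix J J' x
      assume "J \<in> {J. J \<subseteq> I \<and> card J = d}" "J' \<in> {J. J \<subseteq> I \<and> card J = d}"
        "x \<in> topspace (subtopology Z (U d)) \<inter> cell J \<inter> cell J'"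
      then have "J = J'"
        using cell_unique[of J J' x] by auto
      then show "f J i x = f J' i x"
        by simp
    next
      fix x assume "x \<in> topspace (subtopology Z (U d))"
      then have "x \<in> U d"
        by simp
      then show "\<exists>J. J \<in> {J. J \<subseteq> I \<and> card J = d} \<and> x \<in> cell J \<and> \<theta> d i x = f J i x"
        using in_U[of x d] \<theta>_eq by blast
    qed
  next
    fix d i x assume i: "i \<in> I" and x: "x \<in> U d"
    then obtain J where J: "J \<subseteq> I" "card J = d" "x \<in> cell J"
      using in_U by blast
    then have n: "norm (\<xi> i x) = 1"
      using nrm[OF i] by (simp add: cell_def)
    show "cis (\<theta> d i x) = \<xi> i x"
      unfolding \<theta>_eq[OF J] f_def by (simp add: norm_1_Arg[OF n])
    show "\<theta> d i x = 0" if "\<xi> i x = 1"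
    proof -
      have "i \<notin> J"
        using J(3) that by (auto simp: cell_def \<tau>_def)
      then show ?thesis
        unfolding \<theta>_eq[OF J] f_def using that Arg_of_real[of 1] by simp
    qed
  qed
qed

text \<open>Coordinates equal to 1 stay equal to 1, so the set of the others can only shrink, and
  subsets of cliques are cliques.\<close>

lemma scaled_arguments_in_raag_complex:
  assumes x: "x \<in> topspace (raag_complex n E)"
    and \<phi>: "\<And>v. v \<in> {1..n} \<Longrightarrow> x v = 1 \<Longrightarrow> \<phi> v = 0"
  shows "(\<lambda>v\<in>{1..n}. cis (\<phi> v)) \<in> topspace (raag_complex n E)"
proof -
  have "{v \<in> {1..n}. (\<lambda>v\<in>{1..n}. cis (\<phi> v)) v \<noteq> 1} \<subseteq> {v \<in> {1..n}. x v \<noteq> 1}"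
    using \<phi> by (force simp: cis_zero)
  then have "clique {v \<in> {1..n}. (\<lambda>v\<in>{1..n}. cis (\<phi> v)) v \<noteq> 1} E"
    using x unfolding clique_def topspace_raag_complex by blast
  then show ?thesis
    by (auto simp: topspace_raag_complex)
qed

lemma continuous_map_cis:
  assumes "continuous_map Z euclideanreal f"
  shows "continuous_map Z euclidean (\<lambda>z. cis (f z))"
proof -
  have "continuous_map euclideanreal euclidean cis"
    by (auto simp: cis_conv_exp intro!: continuous_intros)
  from continuous_map_compose[OF assms this] show ?thesis
    by (simp add: o_def)
qed

lemma LS_category_raag_complex_le:
  assumes w: "\<And>K. K \<subseteq> {1..n} \<Longrightarrow> clique K E \<Longrightarrow> card K \<le> w"
  shows "LS_category (raag_complex n E) \<le> enat w"
proof -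
  let ?X = "raag_complex n E"
  have card: "card {v \<in> {1..n}. x v \<noteq> 1} \<le> w" if "x \<in> topspace ?X" for x
    by (rule w) (use that in \<open>auto simp: topspace_raag_complex\<close>)
  have coord: "continuous_map ?X euclidean (\<lambda>x. x v)" if "v \<in> {1..n}" for v
    by (rule continuous_map_raag_complex_coordinate[OF that])
  have nrm: "norm (x v) = 1" if "v \<in> {1..n}" "x \<in> topspace ?X" for v x
    by (rule raag_complex_coordinate_nonzero(2)[OF that(2,1)])
  obtain U \<theta> where U [rule_format]: "\<forall>d. openin ?X (U d)" "topspace ?X \<subseteq> (\<Union>d\<in>{0..w}. U d)"
    and \<theta> [rule_format]: "\<forall>d. \<forall>v\<in>{1..n}. continuous_map (subtopology ?X (U d)) euclideanreal (\<theta> d v)"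
      "\<forall>d. \<forall>v\<in>{1..n}. \<forall>x\<in>U d. cis (\<theta> d v x) = x v"
      "\<forall>d. \<forall>v\<in>{1..n}. \<forall>x\<in>U d. x v = 1 \<longrightarrow> \<theta> d v x = 0"
    by (rule circle_coordinates_cover[of "{1..n}" ?X "\<lambda>v x. x v" w], rule finite_atLeastAtMost,
        erule coord, erule (1) nrm, erule card)
  show ?thesis
    unfolding LS_category_def
  proof (rule open_cover_number_le_enat[where U = U])
    fix d
    let ?Z = "subtopology ?X (U d)"
    define h where "h = (\<lambda>(t::real, x). \<lambda>v\<in>{1..n}. cis ((1 - t) * \<theta> d v x))"
    have UX: "x \<in> topspace ?X" if "x \<in> U d" for x
      using that U(1)[of d] openin_subset by blast
    have "homotopic_with (\<lambda>_. True) ?Z ?X (\<lambda>x. x) (\<lambda>_. \<lambda>v\<in>{1..n}. 1)"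
    proof (subst homotopic_with, simp, intro exI[of _ h] conjI ballI)
      show "continuous_map (prod_topology (top_of_set {0..1::real}) ?Z) ?X h"
      proof (rule continuous_map_into_raag_complex)
        fix v assume v: "v \<in> {1..n}"
        have "continuous_map (prod_topology (top_of_set {0..1::real}) ?Z) euclideanreal (\<lambda>z. (1 - fst z) * \<theta> d v (snd z))"
          using \<theta>(1)[OF v] continuous_map_compose[OF continuous_map_snd[of "top_of_set {0..1::real}"] \<theta>(1)[OF v]]
            continuous_map_into_fulltopology[OF continuous_map_fst[of "top_of_set {0..1::real}" ?Z]]
          by (intro continuous_map_real_mult continuous_map_diff) (auto simp: o_def)
        from continuous_map_cis[OF this]
        show "continuous_map (prod_topology (top_of_set {0..1::real}) ?Z) euclidean (\<lambda>z. h z v)"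
          using v by (simp add: h_def case_prod_beta)
      next
        fix z assume "z \<in> topspace (prod_topology (top_of_set {0..1::real}) ?Z)"
        then obtain t x where z: "z = (t, x)" "x \<in> U d"
          by auto
        have "(\<lambda>v\<in>{1..n}. cis ((1 - t) * \<theta> d v x)) \<in> topspace ?X"
          by (rule scaled_arguments_in_raag_complex[OF UX[OF z(2)]]) (use \<theta>(3) z(2) in auto)
        then show "h z \<in> topspace ?X"
          by (simp add: h_def z)
      qed
      show "h (0, x) = x" if "x \<in> topspace ?Z" for x
      proof
        fix v show "h (0, x) v = x v"
          using that \<theta>(2)[of v x d] UX[of x] by (cases "v \<in> {1..n}") (auto simp: h_def topspace_raag_complex PiE_def extensional_def)
      qed
      show "h (1, x) = (\<lambda>v\<in>{1..n}. 1)" for x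
        by (auto simp: h_def)
    qed auto
    then show "\<exists>a. homotopic_with (\<lambda>_. True) ?Z ?X (\<lambda>x. x) (\<lambda>_. a)"
      by blast
  qed (use U in auto)
qed

lemma higher_TC_raag_complex_le:
  assumes s: "s \<ge> 1"
    and w: "\<And>K. K \<subseteq> {1..n} \<Longrightarrow> clique K E \<Longrightarrow> card K \<le> w"
  shows "higher_TC s (raag_complex n E) \<le> enat (s * w)"
proof (cases "s = 1")
  case True
  moreover have "LS_category (raag_complex n E) \<le> enat w"
    by (rule LS_category_raag_complex_le) (rule w)
  ultimately show ?thesis
    by (simp add: higher_TC_def)
next
  case False
  let ?X = "raag_complex n E"
  let ?Y = "product_topology (\<lambda>_. ?X) {1..s}"
  let ?I = "{1..s} \<times> {1..n}"
  let ?W = "interval_wedge s"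
  have proj: "continuous_map ?Y ?X (\<lambda>x. x a)" if "a \<in> {1..s}" for a
    by (rule continuous_map_product_projection[OF that])
  have Yc: "x a \<in> topspace ?X" if "x \<in> topspace ?Y" "a \<in> {1..s}" for x a
    using that by auto
  have coord: "continuous_map ?Y euclidean (\<lambda>x. x (fst i) (snd i))" if "i \<in> ?I" for i
    using continuous_map_compose[OF proj continuous_map_raag_complex_coordinate] that
    by (auto simp: o_def)
  have nrm: "norm (x (fst i) (snd i)) = 1" if "i \<in> ?I" "x \<in> topspace ?Y" for i x
    by (rule raag_complex_coordinate_nonzero(2)[OF Yc[OF that(2)]]) (use that in auto)
  have card: "card {i \<in> ?I. x (fst i) (snd i) \<noteq> 1} \<le> s * w" if x: "x \<in> topspace ?Y" for x
  proof -
    have "{i \<in> ?I. x (fst i) (snd i) \<noteq> 1} = Sigma {1..s} (\<lambda>a. {v \<in> {1..n}. x a v \<noteq> 1})"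
      by auto
    then have "card {i \<in> ?I. x (fst i) (snd i) \<noteq> 1} = (\<Sum>a=1..s. card {v \<in> {1..n}. x a v \<noteq> 1})"
      by simp
    also have "\<dots> \<le> (\<Sum>a=1..s. w)"
      by (intro sum_mono w) (use Yc[OF x] in \<open>auto simp: topspace_raag_complex\<close>)
    finally show ?thesis
      by simp
  qed
  obtain U \<theta> where U [rule_format]: "\<forall>d. openin ?Y (U d)" "topspace ?Y \<subseteq> (\<Union>d\<in>{0..s * w}. U d)"
    and \<theta> [rule_format]: "\<forall>d. \<forall>i\<in>?I. continuous_map (subtopology ?Y (U d)) euclideanreal (\<theta> d i)"
      "\<forall>d. \<forall>i\<in>?I. \<forall>x\<in>U d. cis (\<theta> d i x) = x (fst i) (snd i)"
      "\<forall>d. \<forall>i\<in>?I. \<forall>x\<in>U d. x (fst i) (snd i) = 1 \<longrightarrow> \<theta> d i x = 0"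
    by (rule circle_coordinates_cover[of ?I ?Y "\<lambda>i x. x (fst i) (snd i)" "s * w"],
        rule finite_cartesian_product[OF finite_atLeastAtMost finite_atLeastAtMost],
        erule coord, erule (1) nrm, erule card)
  have "open_cover_number ?Y (\<lambda>U. \<exists>\<sigma>. continuous_map (subtopology ?Y U) (compact_open_topology ?W ?X) \<sigma> \<and>
        (\<forall>x\<in>U. endpoint_map s (\<sigma> x) = x)) \<le> enat (s * w)"
  proof (rule open_cover_number_le_enat[where U = U])
    fix d
    let ?Z = "subtopology ?Y (U d)"
    have UY: "x \<in> topspace ?Y" if "x \<in> U d" for x
      using that U(1)[of d] openin_subset by blast
    define \<rho> :: "nat \<Rightarrow> nat \<times> real \<Rightarrow> real" where "\<rho> = (\<lambda>a (j, t). if j = a then t else 0)"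
    \<comment> \<open>On arm \<open>a\<close> at height t the arguments of the a-th point are scaled
      by t, so all arms start at the point (1, ..., 1). The sum over all arms has at most one
      nonzero term and gives continuity on the wedge without cases.\<close>
    define H where "H = (\<lambda>x y. \<lambda>v\<in>{1..n}. cis (\<Sum>a=1..s. \<rho> a y * \<theta> d (a, v) x))"
    have sum_eq: "(\<Sum>a=1..s. \<rho> a (j, t) * \<theta> d (a, v) x) = (if j \<in> {1..s} then t * \<theta> d (j, v) x else 0)"
      for j t v x
    proof -
      have "(\<Sum>a=1..s. \<rho> a (j, t) * \<theta> d (a, v) x) = (\<Sum>a=1..s. if j = a then t * \<theta> d (a, v) x else 0)"
        by (intro sum.cong) (auto simp: \<rho>_def)
      then show ?thesis
        by simp
    qed
    have H_cont: "continuous_map (prod_topology ?Z ?W) ?X (\<lambda>(x, y). H x y)"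
    proof (rule continuous_map_into_raag_complex)
      fix v assume v: "v \<in> {1..n}"
      have "continuous_map (prod_topology ?Z ?W) euclideanreal
          (\<lambda>z. \<Sum>a=1..s. \<rho> a (snd z) * \<theta> d (a, v) (fst z))"
      proof (intro continuous_map_sum continuous_map_real_mult)
        fix a assume a: "a \<in> {1..s}"
        then have "continuous_map ?W euclideanreal (\<rho> a)"
          unfolding \<rho>_def by (intro continuous_map_wedge_coordinate) simp
        from continuous_map_compose[OF continuous_map_snd[of ?Z] this]
        show "continuous_map (prod_topology ?Z ?W) euclideanreal (\<lambda>z. \<rho> a (snd z))"
          by (simp add: o_def)
        have "(a, v) \<in> ?I"
          using a v by simp
        from continuous_map_compose[OF continuous_map_fst[of _ ?W] \<theta>(1)[OF this]]
        show "continuous_map (prod_topology ?Z ?W) euclideanreal (\<lambda>z. \<theta> d (a, v) (fst z))"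
          by (simp add: o_def)
      qed simp
      from continuous_map_cis[OF this]
      show "continuous_map (prod_topology ?Z ?W) euclidean (\<lambda>z. (case z of (x, y) \<Rightarrow> H x y) v)"
        using v by (simp add: H_def case_prod_beta)
    next
      fix z assume "z \<in> topspace (prod_topology ?Z ?W)"
      then obtain x j t where z: "z = (x, (j, t))" and x: "x \<in> U d"
        by (metis IntE SigmaE prod.collapse topspace_prod_topology topspace_subtopology)
      \<comment> \<open>The common point carries the label 0, which is not a factor. All arguments
        are 0 there, so any factor can witness membership.\<close>
      define k where "k = (if j \<in> {1..s} then j else 1)"
      have k: "k \<in> {1..s}"
        using s by (auto simp: k_def)
      have "H x (j, t) \<in> topspace ?X"
        unfolding H_def
      proof (rule scaled_arguments_in_raag_complex[OF Yc[OF UY[OF x] k]])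
        fix v assume "v \<in> {1..n}" "x k v = 1"
        then show "(\<Sum>a=1..s. \<rho> a (j, t) * \<theta> d (a, v) x) = 0"
          using \<theta>(3)[of "(k, v)" x d] k x unfolding sum_eq by (auto simp: k_def)
      qed
      then show "(case z of (x, y) \<Rightarrow> H x y) \<in> topspace ?X"
        by (simp add: z)
    qed
    show "\<exists>\<sigma>. continuous_map ?Z (compact_open_topology ?W ?X) \<sigma> \<and> (\<forall>x\<in>U d. endpoint_map s (\<sigma> x) = x)"
    proof (intro exI conjI ballI)
      show "continuous_map ?Z (compact_open_topology ?W ?X) (\<lambda>x. restrict (H x) (topspace ?W))"
        by (rule continuous_map_into_compact_open[OF H_cont])
      fix x assume x: "x \<in> U d"
      show "endpoint_map s (restrict (H x) (topspace ?W)) = x"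
      proof
        fix a show "endpoint_map s (restrict (H x) (topspace ?W)) a = x a"
        proof (cases "a \<in> {1..s}")
          case True
          have "(a, 1) \<in> topspace ?W"
            unfolding interval_wedge_def topspace_quotient_topology using True
            by (auto intro!: image_eqI[of _ _ "(a, 1)"])
          moreover have "H x (a, 1) = x a"
          proof
            fix v show "H x (a, 1) v = x a v"
              using \<theta>(2)[of "(a, v)" x d] True x Yc[OF UY[OF x] True] sum_eq[of a 1 v x]
              by (cases "v \<in> {1..n}") (auto simp: H_def topspace_raag_complex PiE_def extensional_def)
          qed
          ultimately show ?thesis
            using True by (simp add: endpoint_map_def)
        next
          case False
          then show ?thesis
            using UY[OF x] by (auto simp: endpoint_map_def PiE_def extensional_def)
        qed
      qed
    qed
  qed (use U in auto)
  then show ?thesis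
    using False by (simp add: higher_TC_def)
qed

lemma higher_TC_raag_complex_ge_disjoint_cliques:
  assumes s: "s \<ge> 1" and A: "A \<in> nsets {1..n} k" "clique A E" and B: "B \<in> nsets {1..n} k" "clique B E"
    and disj: "A \<inter> B = {}"
  shows "enat (s * k) \<le> higher_TC s (raag_complex n E)"
proof (cases "s = 1")
  case True
  then show ?thesis
    using LS_category_raag_complex_ge[of A n E] A by (simp add: higher_TC_def nsets_def)
next
  case False
  then have s2: "s \<ge> 2"
    using s by simp
  \<comment> \<open>\<open>A\<close> on the first factor and \<open>B\<close> on all others: every
    factor then has one with a disjoint clique.\<close>
  define K where "K = (\<lambda>a::nat. if a = 1 then A else B)"
  have "enat (\<Sum>a=1..s. card (K a)) \<le> higher_TC s (raag_complex n E)"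
  proof (rule higher_TC_raag_complex_ge[OF False])
    show "K a \<subseteq> {1..n}" "clique (K a) E" for a
      using A B by (auto simp: K_def nsets_def)
    show "\<exists>b\<in>{1..s}. K a \<inter> K b = {}" for a
    proof (cases "a = 1")
      case True
      then show ?thesis
        using s2 disj by (intro bexI[of _ 2]) (auto simp: K_def)
    next
      case False
      then show ?thesis
        using s2 disj by (intro bexI[of _ 1]) (auto simp: K_def)
    qed
  qed
  moreover have "card (K a) = k" for a
    using A B by (simp add: K_def nsets_def)
  ultimately show ?thesis
    by simp
qed

section \<open>Cliques in random graphs\<close>

lemma prob_random_graph_superset:
  assumes "S \<subseteq> nsets {1..n} 2" "0 \<le> p" "p \<le> 1"
  shows "measure_pmf.prob (random_graph n p) {\<Gamma>. S \<subseteq> \<Gamma>} = p ^ card S"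
proof -
  let ?A = "nsets {1..n} 2"
  have fin: "finite ?A"
    by (simp add: finite_imp_finite_nsets)
  \<comment> \<open>The event is a box, with edges of \<open>S\<close> forced and the others free,
    so independence turns its probability into a product.\<close>
  have "(\<lambda>b. {e. b e}) -` {\<Gamma>. S \<subseteq> \<Gamma>} = Pi ?A (\<lambda>e. if e \<in> S then {True} else UNIV)"
    using assms(1) by (force simp: Pi_def split: if_splits)
  then have "measure_pmf.prob (random_graph n p) {\<Gamma>. S \<subseteq> \<Gamma>} =
      (\<Prod>e\<in>?A. measure_pmf.prob (bernoulli_pmf p) (if e \<in> S then {True} else UNIV))"
    unfolding random_graph_def measure_map_pmf by (simp only: measure_Pi_pmf_Pi[OF fin])
  also have "\<dots> = (\<Prod>e\<in>?A. if e \<in> S then p else 1)"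
    using assms by (intro prod.cong) (auto simp: measure_pmf_single)
  also have "\<dots> = p ^ card S"
    using fin assms(1) by (simp add: prod.If_cases Int_absorb1)
  finally show ?thesis .
qed

lemma clique_iff_nsets: "clique A \<Gamma> \<longleftrightarrow> nsets A 2 \<subseteq> \<Gamma>"
  by (force simp: clique_def nsets_2_eq)

text \<open>The edges inside \<open>A \<inter> B\<close> are shared; the power of 1 / p corrects for
  counting them twice. In particular disjoint cliques are independent.\<close>

lemma prob_two_cliques:
  assumes A: "A \<subseteq> {1..n}" "card A = k" and B: "B \<subseteq> {1..n}" "card B = k"
    and p: "0 < p" "p \<le> 1"
  shows "measure_pmf.prob (random_graph n p) {\<Gamma>. clique A \<Gamma> \<and> clique B \<Gamma>} =
    (p ^ (k choose 2))\<^sup>2 * (1 / p) ^ (card (A \<inter> B) choose 2)"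
proof -
  have fin: "finite A" "finite B"
    using A B finite_subset by blast+
  have "nsets A 2 \<union> nsets B 2 \<subseteq> nsets {1..n} 2"
    using A B by (auto simp: nsets_def)
  then have "measure_pmf.prob (random_graph n p) {\<Gamma>. nsets A 2 \<union> nsets B 2 \<subseteq> \<Gamma>} =
      p ^ card (nsets A 2 \<union> nsets B 2)"
    using p by (intro prob_random_graph_superset) auto
  moreover have "card (nsets A 2 \<union> nsets B 2) + (card (A \<inter> B) choose 2) = 2 * (k choose 2)"
  proof -
    have "nsets A 2 \<inter> nsets B 2 = nsets (A \<inter> B) 2"
      by (auto simp: nsets_def)
    then show ?thesis
      using card_Un_Int[of "nsets A 2" "nsets B 2"] fin A B by (simp add: finite_imp_finite_nsets)
  qed
  then have "p ^ card (nsets A 2 \<union> nsets B 2) * p ^ (card (A \<inter> B) choose 2) = (p ^ (k choose 2))\<^sup>2"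
    by (metis power_add power_mult mult.commute)
  ultimately show ?thesis
    using p by (simp add: clique_iff_nsets power_one_over field_simps)
qed

lemma prob_clique:
  assumes "A \<subseteq> {1..n}" "0 < p" "p \<le> 1"
  shows "measure_pmf.prob (random_graph n p) {\<Gamma>. clique A \<Gamma>} = p ^ (card A choose 2)"
proof -
  have "nsets A 2 \<subseteq> nsets {1..n} 2"
    using assms by (auto simp: nsets_def)
  then show ?thesis
    using prob_random_graph_superset[of "nsets A 2" n p] assms by (simp add: clique_iff_nsets)
qed

lemma prob_ex_clique_le:
  assumes "0 < p" "p \<le> 1"
  shows "measure_pmf.prob (random_graph n p) {\<Gamma>. \<exists>A\<in>nsets {1..n} k. clique A \<Gamma>}
    \<le> real (n choose k) * p ^ (k choose 2)"
proof -
  let ?M = "measure_pmf (random_graph n p)" and ?N = "nsets {1..n} k"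
  have "measure ?M {\<Gamma>. \<exists>A\<in>?N. clique A \<Gamma>} = measure ?M (\<Union>A\<in>?N. {\<Gamma>. clique A \<Gamma>})"
    by (rule arg_cong[where f = "measure ?M"]) auto
  also have "\<dots> \<le> (\<Sum>A\<in>?N. measure ?M {\<Gamma>. clique A \<Gamma>})"
    by (intro measure_pmf.finite_measure_subadditive_finite) (auto simp: finite_imp_finite_nsets)
  also have "\<dots> = (\<Sum>A\<in>?N. p ^ (k choose 2))"
    using assms by (intro sum.cong) (auto simp: nsets_def prob_clique)
  finally show ?thesis
    by simp
qed

lemma card_nsets_fixed_Int:
  assumes V: "finite V" "A \<subseteq> V" "card A = k"
  shows "card {B \<in> nsets V k. card (A \<inter> B) = l} \<le> (k choose l) * ((card V - k) choose (k - l))"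
proof -
  let ?S = "{B \<in> nsets V k. card (A \<inter> B) = l}"
  have finA: "finite A"
    using V finite_subset by blast
  have "card ?S \<le> card (nsets A l \<times> nsets (V - A) (k - l))"
  proof (rule card_inj_on_le[where f = "\<lambda>B. (A \<inter> B, B - A)"])
    show "inj_on (\<lambda>B. (A \<inter> B, B - A)) ?S"
      by (auto simp: inj_on_def)
    show "(\<lambda>B. (A \<inter> B, B - A)) ` ?S \<subseteq> nsets A l \<times> nsets (V - A) (k - l)"
    proof clarsimp
      fix B assume B: "B \<in> nsets V k" "l = card (A \<inter> B)"
      then have "card (B - A) = k - card (A \<inter> B)"
        using card_Diff_subset_Int[of B A] finA by (simp add: nsets_def Int_commute)
      then show "A \<inter> B \<in> nsets A (card (A \<inter> B)) \<and> B - A \<in> nsets (V - A) (k - card (A \<inter> B))"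
        using B finA by (auto simp: nsets_def)
    qed
    show "finite (nsets A l \<times> nsets (V - A) (k - l))"
      using finA V by (simp add: finite_imp_finite_nsets)
  qed
  also have "\<dots> = (k choose l) * ((card V - k) choose (k - l))"
    using V finA by (simp add: card_cartesian_product card_Diff_subset)
  finally show ?thesis .
qed

text \<open>
  With \<open>X\<close> the number of \<open>k\<close>-cliques and \<open>Y\<close> the number of ordered pairs of intersecting ones,
  \<open>X\<^sup>2 = Y\<close> if there is no disjoint pair, and then \<open>(X - \<mu>)\<^sup>2 + Y \<ge> \<mu>\<^sup>2 / 2\<close> for \<open>\<mu> = E X\<close>.
  Since disjoint pairs are independent, \<open>Var X \<le> E Y\<close>, and Markov's inequality applies.
\<close>

lemma prob_no_disjoint_cliques_le:
  assumes p: "0 < p" "p \<le> 1" and k: "k \<le> n"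
  shows "measure_pmf.prob (random_graph n p)
      {\<Gamma>. \<not> (\<exists>A\<in>nsets {1..n} k. \<exists>B\<in>nsets {1..n} k. clique A \<Gamma> \<and> clique B \<Gamma> \<and> A \<inter> B = {})}
    \<le> 4 * (\<Sum>l=1..k. real ((k choose l) * ((n - k) choose (k - l))) / real (n choose k) *
                        (1 / p) ^ (l choose 2))"
proof -
  let ?M = "measure_pmf (random_graph n p)"
  define N where "N = nsets {1..n} k"
  define P where "P = p ^ (k choose 2)"
  define \<mu> where "\<mu> = real (n choose k) * P"
  define c where "c = (\<lambda>(A :: nat set) B \<Gamma>. indicator {\<Gamma>. clique A \<Gamma> \<and> clique B \<Gamma>} \<Gamma> :: real)"
  define Q where "Q = {(A, B) \<in> N \<times> N. A \<inter> B \<noteq> {}}"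
  define X where "X = (\<lambda>\<Gamma>. \<Sum>A\<in>N. c A A \<Gamma>)"
  define Y where "Y = (\<lambda>\<Gamma>. \<Sum>(A, B)\<in>Q. c A B \<Gamma>)"
  have finN: "finite N" and cardN: "card N = n choose k"
    by (simp_all add: N_def finite_imp_finite_nsets)
  then have finQ: "finite Q"
    by (auto simp: Q_def intro: finite_subset[of _ "N \<times> N"])
  have P0: "P > 0"
    using p by (simp add: P_def)
  have \<mu>0: "\<mu> > 0"
    using P0 k by (simp add: \<mu>_def)
  have int_c [simp]: "integrable ?M (c A B)" for A B
    unfolding c_def by (intro integrable_real_indicator) (auto simp: less_top[symmetric])
  have Ec: "(\<integral>\<Gamma>. c A B \<Gamma> \<partial>?M) = P\<^sup>2 * (1 / p) ^ (card (A \<inter> B) choose 2)" if "A \<in> N" "B \<in> N" for A B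
    using that p prob_two_cliques[of A n k B p] by (auto simp: c_def N_def nsets_def P_def)
  have EcA: "(\<integral>\<Gamma>. c A A \<Gamma> \<partial>?M) = P" if "A \<in> N" for A
    using that p prob_clique[of A n p] by (auto simp: c_def N_def nsets_def P_def)
  have X2: "(X \<Gamma>)\<^sup>2 = (\<Sum>(A, B)\<in>N \<times> N. c A B \<Gamma>)" for \<Gamma>
    unfolding X_def power2_eq_square sum_product sum.cartesian_product
    by (intro sum.cong) (auto simp: c_def indicator_def)
  have X2_split: "(X \<Gamma>)\<^sup>2 = Y \<Gamma> + (\<Sum>(A, B)\<in>N \<times> N - Q. c A B \<Gamma>)" for \<Gamma>
    unfolding X2 Y_def using finN
    by (subst sum.subset_diff[of Q "N \<times> N"]) (auto simp: Q_def)
  have EX: "(\<integral>\<Gamma>. X \<Gamma> \<partial>?M) = \<mu>"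
    unfolding X_def using EcA cardN by (subst Bochner_Integration.integral_sum) (auto simp: \<mu>_def)
  define y where "y = (\<integral>\<Gamma>. Y \<Gamma> \<partial>?M)"
  have int_Y: "integrable ?M Y"
    unfolding Y_def by (auto intro!: Bochner_Integration.integrable_sum)
  have int_X: "integrable ?M X"
    unfolding X_def by (auto intro!: Bochner_Integration.integrable_sum)
  have int_D: "integrable ?M (\<lambda>\<Gamma>. \<Sum>(A, B)\<in>N \<times> N - Q. c A B \<Gamma>)"
    by (auto intro!: Bochner_Integration.integrable_sum)
  have int_X2: "integrable ?M (\<lambda>\<Gamma>. (X \<Gamma>)\<^sup>2)"
    unfolding X2_split using int_Y int_D by simp
  have "(\<integral>\<Gamma>. (\<Sum>(A, B)\<in>N \<times> N - Q. c A B \<Gamma>) \<partial>?M) \<le> \<mu>\<^sup>2"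
  proof -
    have "(\<integral>\<Gamma>. (\<Sum>(A, B)\<in>N \<times> N - Q. c A B \<Gamma>) \<partial>?M) = (\<Sum>(A, B)\<in>N \<times> N - Q. \<integral>\<Gamma>. c A B \<Gamma> \<partial>?M)"
      by (subst Bochner_Integration.integral_sum) (auto simp: case_prod_unfold)
    also have "\<dots> = (\<Sum>(A, B)\<in>N \<times> N - Q. P\<^sup>2)"
      by (intro sum.cong) (auto simp: Ec Q_def binomial_eq_0)
    also have "\<dots> \<le> (\<Sum>(A, B)\<in>N \<times> N. P\<^sup>2)"
      using finN by (intro sum_mono2) auto
    also have "\<dots> = \<mu>\<^sup>2"
      by (simp add: \<mu>_def card_cartesian_product cardN power2_eq_square)
    finally show ?thesis .
  qed
  then have EX2: "(\<integral>\<Gamma>. (X \<Gamma>)\<^sup>2 \<partial>?M) \<le> y + \<mu>\<^sup>2"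
    unfolding X2_split y_def using int_Y int_D by simp
  \<comment> \<open>Adding Y to the squared deviation allows a single use of Markov's inequality. If
    Y = X^2, then W = 2 (X - \<mu>/2)^2 + \<mu>^2/2, whence the level \<mu>^2/2; with E W \<le> 2 E
    Y this gives the constant 4.\<close>
  define W where "W = (\<lambda>\<Gamma>. (X \<Gamma> - \<mu>)\<^sup>2 + Y \<Gamma>)"
  have W_eq: "W = (\<lambda>\<Gamma>. (X \<Gamma>)\<^sup>2 - 2 * \<mu> * X \<Gamma> + \<mu>\<^sup>2 + Y \<Gamma>)"
    by (simp add: W_def power2_diff fun_eq_iff algebra_simps)
  have int_W: "integrable ?M W"
    unfolding W_eq using int_X2 int_X int_Y by simp
  have EW: "(\<integral>\<Gamma>. W \<Gamma> \<partial>?M) \<le> 2 * y"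
  proof -
    have "(\<integral>\<Gamma>. W \<Gamma> \<partial>?M) = (\<integral>\<Gamma>. (X \<Gamma>)\<^sup>2 \<partial>?M) - 2 * \<mu> * \<mu> + \<mu>\<^sup>2 + y"
      unfolding W_eq using int_X2 int_X int_Y by (simp add: EX y_def measure_pmf.prob_space)
    then show ?thesis
      using EX2 by (simp add: power2_eq_square)
  qed
  have Y0: "Y \<Gamma> \<ge> 0" for \<Gamma>
    unfolding Y_def by (intro sum_nonneg) (auto simp: c_def)
  have "measure ?M {\<Gamma>. \<not> (\<exists>A\<in>N. \<exists>B\<in>N. clique A \<Gamma> \<and> clique B \<Gamma> \<and> A \<inter> B = {})}
      \<le> measure ?M {\<Gamma> \<in> space ?M. W \<Gamma> \<ge> \<mu>\<^sup>2 / 2}"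
  proof (rule measure_pmf.finite_measure_mono)
    show "{\<Gamma>. \<not> (\<exists>A\<in>N. \<exists>B\<in>N. clique A \<Gamma> \<and> clique B \<Gamma> \<and> A \<inter> B = {})} \<subseteq> {\<Gamma> \<in> space ?M. W \<Gamma> \<ge> \<mu>\<^sup>2 / 2}"
    proof clarsimp
      fix \<Gamma> assume no: "\<forall>A\<in>N. clique A \<Gamma> \<longrightarrow> (\<forall>B\<in>N. clique B \<Gamma> \<longrightarrow> A \<inter> B \<noteq> {})"
      have "(\<Sum>(A, B)\<in>N \<times> N - Q. c A B \<Gamma>) = 0"
        by (intro sum.neutral) (use no in \<open>auto simp: Q_def c_def indicator_def\<close>)
      then have "Y \<Gamma> = (X \<Gamma>)\<^sup>2"
        by (simp add: X2_split)
      then have "W \<Gamma> - \<mu>\<^sup>2 / 2 = 2 * (X \<Gamma> - \<mu> / 2)\<^sup>2"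
        by (simp add: W_def power2_eq_square field_simps)
      then show "\<mu>\<^sup>2 \<le> W \<Gamma> * 2"
        using zero_le_power2[of "X \<Gamma> - \<mu> / 2"] by linarith
    qed
  qed auto
  also have "\<dots> \<le> (\<integral>\<Gamma>. W \<Gamma> \<partial>?M) / (\<mu>\<^sup>2 / 2)"
    using int_W \<mu>0 Y0 by (intro integral_Markov_inequality_measure[where A = UNIV]) (auto simp: W_def)
  also have "\<dots> \<le> 2 * y / (\<mu>\<^sup>2 / 2)"
    using EW \<mu>0 by (intro divide_right_mono) auto
  also have "\<dots> = 4 * (y / \<mu>\<^sup>2)"
    by simp
  also have "y / \<mu>\<^sup>2 \<le> (\<Sum>l=1..k. real ((k choose l) * ((n - k) choose (k - l))) / real (n choose k) *
                        (1 / p) ^ (l choose 2))"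
  proof -
    have "y = (\<Sum>(A, B)\<in>Q. P\<^sup>2 * (1 / p) ^ (card (A \<inter> B) choose 2))"
      unfolding y_def Y_def
      by (subst Bochner_Integration.integral_sum) (auto simp: case_prod_unfold Q_def intro!: sum.cong Ec)
    also have "\<dots> = (\<Sum>A\<in>N. \<Sum>B\<in>{B\<in>N. A \<inter> B \<noteq> {}}. P\<^sup>2 * (1 / p) ^ (card (A \<inter> B) choose 2))"
      unfolding Q_def using finN by (subst sum.Sigma) (auto intro!: sum.cong)
    also have "\<dots> \<le> (\<Sum>A\<in>N. \<Sum>l=1..k. real ((k choose l) * ((n - k) choose (k - l))) * (P\<^sup>2 * (1 / p) ^ (l choose 2)))"
    proof (rule sum_mono)
      fix A assume "A \<in> N"
      then have A: "A \<subseteq> {1..n}" "card A = k" "finite A"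
        by (auto simp: N_def nsets_def)
      let ?B = "{B\<in>N. A \<inter> B \<noteq> {}}"
      have "(\<Sum>B\<in>?B. P\<^sup>2 * (1 / p) ^ (card (A \<inter> B) choose 2)) =
          (\<Sum>l=1..k. \<Sum>B\<in>{B \<in> ?B. card (A \<inter> B) = l}. P\<^sup>2 * (1 / p) ^ (card (A \<inter> B) choose 2))"
      proof (rule sum.group[symmetric])
        show "(\<lambda>B. card (A \<inter> B)) ` ?B \<subseteq> {1..k}"
          using A card_mono[OF A(3), of "A \<inter> B" for B] by (auto simp: Suc_le_eq card_gt_0_iff)
      qed (use finN in auto)
      also have "\<dots> = (\<Sum>l=1..k. real (card {B \<in> ?B. card (A \<inter> B) = l}) * (P\<^sup>2 * (1 / p) ^ (l choose 2)))"
        by (intro sum.cong) auto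
      also have "\<dots> \<le> (\<Sum>l=1..k. real ((k choose l) * ((n - k) choose (k - l))) * (P\<^sup>2 * (1 / p) ^ (l choose 2)))"
      proof (intro sum_mono mult_right_mono of_nat_mono)
        fix l
        have "card {B \<in> ?B. card (A \<inter> B) = l} \<le> card {B \<in> N. card (A \<inter> B) = l}"
          using finN by (intro card_mono) auto
        also have "\<dots> \<le> (k choose l) * ((n - k) choose (k - l))"
          unfolding N_def using card_nsets_fixed_Int[of "{1..n}" A k l] A by simp
        finally show "card {B \<in> ?B. card (A \<inter> B) = l} \<le> (k choose l) * ((n - k) choose (k - l))" .
      qed (use p P0 in auto)
      finally show "(\<Sum>B\<in>?B. P\<^sup>2 * (1 / p) ^ (card (A \<inter> B) choose 2)) \<le>
          (\<Sum>l=1..k. real ((k choose l) * ((n - k) choose (k - l))) * (P\<^sup>2 * (1 / p) ^ (l choose 2)))" .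
    qed
    also have "\<dots> = \<mu>\<^sup>2 * (\<Sum>l=1..k. real ((k choose l) * ((n - k) choose (k - l))) / real (n choose k) *
                        (1 / p) ^ (l choose 2))"
      using k by (simp add: \<mu>_def cardN sum_distrib_left power2_eq_square field_simps)
    finally show ?thesis
      using \<mu>0 by (simp add: field_simps)
  qed
  finally show ?thesis
    by (simp add: N_def)
qed

section \<open>Elementary estimates for factorials and overlaps\<close>

lemma fact_ge_div_exp_power: "(real k / exp 1) ^ k \<le> fact k"
proof (induction k)
  case (Suc k)
  have "(1 + 1 / real k) ^ k \<le> exp 1" if "k > 0"
  proof -
    have "(1 + 1 / real k) ^ k \<le> exp (1 / real k) ^ k"
      by (intro power_mono exp_ge_add_one_self) auto
    also have "\<dots> = exp 1"
      using that by (simp add: exp_of_nat_mult[symmetric])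
    finally show ?thesis .
  qed
  then have "(real k + 1) ^ k \<le> exp 1 * real k ^ k"
  proof (cases "k = 0")
    case False
    then have "(real k + 1) ^ k = (1 + 1 / real k) ^ k * real k ^ k"
      by (simp add: power_mult_distrib[symmetric] field_simps)
    then show ?thesis
      using False \<open>k > 0 \<Longrightarrow> _\<close> by (simp add: mult_right_mono)
  qed simp
  then have "(real k + 1) * ((real k + 1) ^ k / (exp 1 * exp 1 ^ k))
      \<le> (real k + 1) * (exp 1 * real k ^ k / (exp 1 * exp 1 ^ k))"
    by (intro mult_left_mono divide_right_mono) auto
  then have "(real (Suc k) / exp 1) ^ Suc k \<le> (real k + 1) * (real k / exp 1) ^ k"
    by (simp add: power_divide add.commute)
  also have "\<dots> \<le> (real k + 1) * fact k"
    using Suc by (intro mult_left_mono) auto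
  finally show ?case
    by (simp add: algebra_simps)
qed simp

text \<open>The induction rests on e \<le> (1 + 1/k)^(k+1). Compared with Stirling's formula a
  polynomial factor is lost, which the exponential gain q^(-\<epsilon> k/4) absorbs later.\<close>

lemma fact_le_div_exp_power: "k \<ge> 1 \<Longrightarrow> fact k \<le> exp 1 * real k * (real k / exp 1) ^ k"
proof (induction k rule: dec_induct)
  case base
  then show ?case
    by simp
next
  case (step k)
  then have k: "k > 0"
    by simp
  \<comment> \<open>This is ln x \<le> x - 1 at x = k / (k + 1).\<close>
  have "1 / (real k + 1) \<le> ln (1 + 1 / real k)"
    using ln_one_minus_pos_lower_bound ln_add_one_self_le_self ln_le_minus_one[of "real k / (real k + 1)"] k
    by (simp add: ln_div field_simps)
  then have "1 \<le> real (Suc k) * ln (1 + 1 / real k)"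
    by (simp add: field_simps)
  then have "exp 1 \<le> exp (real (Suc k) * ln (1 + 1 / real k))"
    by simp
  also have "\<dots> = (1 + 1 / real k) ^ Suc k"
    using k by (simp add: exp_of_nat_mult add_pos_nonneg del: of_nat_Suc)
  finally have "exp 1 * real k ^ Suc k \<le> (1 + 1 / real k) ^ Suc k * real k ^ Suc k"
    by (intro mult_right_mono) auto
  also have "\<dots> = (real k + 1) ^ Suc k"
  proof -
    have "(1 + 1 / real k) * real k = real k + 1"
      using k by (simp add: field_simps)
    then show ?thesis
      by (metis power_mult_distrib)
  qed
  finally have "exp 1 * real k ^ Suc k / exp 1 ^ Suc k \<le> (real k + 1) ^ Suc k / exp 1 ^ Suc k"
    by (intro divide_right_mono) auto
  then have "real k * (real k / exp 1) ^ k \<le> (real (Suc k) / exp 1) ^ Suc k"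
    by (simp add: power_divide add.commute)
  then have "exp 1 * real (Suc k) * (real k * (real k / exp 1) ^ k)
      \<le> exp 1 * real (Suc k) * (real (Suc k) / exp 1) ^ Suc k"
    by (intro mult_left_mono) auto
  moreover have "fact (Suc k) \<le> exp 1 * real (Suc k) * (real k * (real k / exp 1) ^ k)"
    using mult_left_mono[OF step.IH, of "real (Suc k)"] by (simp add: algebra_simps)
  ultimately show ?case
    by linarith
qed

text \<open>The right side is the falling factorial of n with k factors, each at least n -
  k.\<close>

lemma power_diff_le_fact_binomial:
  assumes "k \<le> n"
  shows "(n - k) ^ k \<le> fact k * (n choose k)"
proof -
  have "(n - k) ^ j * fact (n - j) \<le> fact n" if "j \<le> k" for j
    using that
  proof (induction j)
    case (Suc j)
    then have f: "fact (n - j) = (n - j) * (fact (n - Suc j) :: nat)"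
      using assms by (metis Suc_diff_Suc Suc_le_lessD fact_Suc less_le_trans of_nat_id)
    have "(n - k) ^ Suc j * fact (n - Suc j) = (n - k) ^ j * ((n - k) * fact (n - Suc j))"
      by simp
    also have "\<dots> \<le> (n - k) ^ j * ((n - j) * fact (n - Suc j))"
      using Suc by (intro mult_le_mono) auto
    also have "\<dots> \<le> fact n"
      using Suc by (simp only: f[symmetric])
    finally show ?case .
  qed simp
  from this[OF order_refl] have "(n - k) ^ k * fact (n - k) \<le> fact k * (n choose k) * fact (n - k)"
    using binomial_fact_lemma[OF assms] by (simp add: algebra_simps)
  then show ?thesis
    by simp
qed

text \<open>Squaring avoids the half-integer exponent (l - 1) / 2.\<close>

lemma power_choose_two: "((q::'a::comm_monoid_mult) ^ (l choose 2))\<^sup>2 = (q ^ (l - 1)) ^ l"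
proof -
  have "even (l * (l - 1))"
    by (cases l) auto
  then have "2 * (l choose 2) = l * (l - 1)"
    unfolding choose_two by (rule dvd_mult_div_cancel)
  then show ?thesis
    by (metis power_mult mult.commute)
qed

text \<open>An upper bound for the contribution of pairs sharing l vertices, shaped so that ratios
  of consecutive terms are simple. At l = k it is essentially the reciprocal of the expected number
  of k-cliques.\<close>

definition overlap_bound :: "real \<Rightarrow> nat \<Rightarrow> nat \<Rightarrow> nat \<Rightarrow> real" where
  "overlap_bound q n k l = (real (k choose l))\<^sup>2 * fact l * q ^ (l choose 2) / real (n - k) ^ l"

text \<open>Bounding (n-k choose k-l) above by (n-k)^(k-l) / (k-l)! and (n choose k) below by
  (n-k)^k / k! leaves a second factor (k choose l) l! / (n-k)^l.\<close>

lemma overlap_term_le: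
  assumes q: "q > 0" and k: "k < n" and l: "l \<le> k"
  shows "real ((k choose l) * ((n - k) choose (k - l))) / real (n choose k) * q ^ (l choose 2)
    \<le> overlap_bound q n k l"
proof -
  have "((n - k) choose (k - l)) * fact (k - l) * (n - k) ^ l \<le> (n - k) ^ (k - l) * (n - k) ^ l"
    by (intro mult_right_mono binomial_fact_pow) auto
  also have "\<dots> = (n - k) ^ k"
    using l by (simp add: power_add[symmetric])
  also have "\<dots> \<le> fact k * (n choose k)"
    using k by (intro power_diff_le_fact_binomial) auto
  also have "\<dots> = (k choose l) * fact l * fact (k - l) * (n choose k)"
    using binomial_fact_lemma[OF l] by (simp add: algebra_simps)
  finally have "((n - k) choose (k - l)) * (n - k) ^ l * fact (k - l) \<le>
      (k choose l) * fact l * (n choose k) * fact (k - l)"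
    by (simp add: algebra_simps)
  then have "((n - k) choose (k - l)) * (n - k) ^ l \<le> (k choose l) * fact l * (n choose k)"
    by simp
  then have "real ((n - k) choose (k - l)) * real (n - k) ^ l \<le> real (k choose l) * fact l * real (n choose k)"
    by (metis of_nat_fact of_nat_le_iff of_nat_mult of_nat_power)
  then have "real ((n - k) choose (k - l)) / real (n choose k) \<le> real (k choose l) * fact l / real (n - k) ^ l"
    using k by (simp add: field_simps)
  then have "real (k choose l) * q ^ (l choose 2) * (real ((n - k) choose (k - l)) / real (n choose k))
      \<le> real (k choose l) * q ^ (l choose 2) * (real (k choose l) * fact l / real (n - k) ^ l)"
    using q by (intro mult_left_mono) auto
  then show ?thesis
    by (simp add: overlap_bound_def power2_eq_square algebra_simps)
qed

text \<open>The ratio of consecutive terms is (k-l)^2 q^l / ((l+1)(n-k)), which is at least q^l / (k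
  n).\<close>

lemma overlap_bound_step:
  assumes q: "q > 1" and k: "k < n" and l: "l < k" and big: "q ^ l \<ge> real k * real n"
  shows "overlap_bound q n k l \<le> overlap_bound q n k (Suc l)"
proof -
  define C where "C = real (k choose l)"
  define C' where "C' = real (k choose Suc l)"
  define R where "R = fact l * q ^ (l choose 2) / real (n - k) ^ l"
  have R: "R \<ge> 0"
    using q by (simp add: R_def)
  have "Suc l * (k choose Suc l) = (k - l) * (k choose l)"
    using binomial_absorption[of l k] binomial_absorb_comp[of k l] by simp
  then have CC': "real (Suc l) * C' = real (k - l) * C"
    unfolding C_def C'_def by (metis of_nat_mult)
  have Suc2: "Suc l choose 2 = (l choose 2) + l"
    by (simp add: numeral_2_eq_2)
  have eq: "overlap_bound q n k (Suc l) = C'\<^sup>2 * (R * (real (Suc l) * q ^ l / real (n - k)))"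
    unfolding overlap_bound_def C'_def[symmetric] R_def Suc2 by (simp add: power_add mult_ac)
  have "real (Suc l) * real (n - k) \<le> real k * real n"
    using l by (intro mult_mono) auto
  also have "\<dots> \<le> q ^ l"
    by (rule big)
  also have "\<dots> \<le> (real (k - l))\<^sup>2 * q ^ l"
    using l q by (simp add: mult_le_cancel_right1 one_le_power)
  finally have "1 \<le> (real (k - l))\<^sup>2 * q ^ l / (real (Suc l) * real (n - k))"
    using k by (simp del: of_nat_Suc add: field_simps)
  then have "C\<^sup>2 * R * 1 \<le> C\<^sup>2 * R * ((real (k - l))\<^sup>2 * q ^ l / (real (Suc l) * real (n - k)))"
    using R by (intro mult_left_mono) auto
  also have "\<dots> = (real (k - l) * C)\<^sup>2 * R * q ^ l / (real (Suc l) * real (n - k))"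
    by (simp add: power_mult_distrib)
  also have "\<dots> = (real (Suc l) * C')\<^sup>2 * R * q ^ l / (real (Suc l) * real (n - k))"
    by (simp only: CC')
  also have "\<dots> = C'\<^sup>2 * (R * (real (Suc l) * q ^ l / real (n - k)))"
    using k by (simp add: power2_eq_square del: of_nat_Suc)
  finally show ?thesis
    unfolding eq by (simp add: overlap_bound_def C_def R_def)
qed

text \<open>Here q^(l choose 2) is at most sqrt(k n)^l and (k choose l)^2 l! at most k^(2l), so the
  term is at most the l-th power of a number below 1, and l \<ge> 1.\<close>

lemma overlap_bound_le_small:
  assumes q: "q > 1" and k: "k < n" and l: "1 \<le> l" "l \<le> k" and small: "q ^ l \<le> real k * real n"
    and b: "(real k)\<^sup>2 * sqrt (real k * real n) / real (n - k) \<le> 1"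
  shows "overlap_bound q n k l \<le> (real k)\<^sup>2 * sqrt (real k * real n) / real (n - k)"
proof -
  define b where "b = (real k)\<^sup>2 * sqrt (real k * real n) / real (n - k)"
  have "(q ^ (l choose 2))\<^sup>2 \<le> (real k * real n) ^ l"
  proof -
    have "q ^ (l - 1) \<le> q ^ l"
      using q by (intro power_increasing) auto
    then have "q ^ (l - 1) \<le> real k * real n"
      using small by simp
    then show ?thesis
      unfolding power_choose_two using q by (intro power_mono) auto
  qed
  then have qle: "q ^ (l choose 2) \<le> sqrt (real k * real n) ^ l"
    by (metis real_le_rsqrt real_sqrt_power)
  have "(k choose l) * fact l \<le> k ^ l"
    by (rule binomial_fact_pow)
  then have c: "real (k choose l) * fact l \<le> real k ^ l"
    by (metis of_nat_fact of_nat_le_iff of_nat_mult of_nat_power)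
  have "real (k choose l) * 1 \<le> real (k choose l) * fact l"
    by (intro mult_left_mono fact_ge_1) auto
  then have "real (k choose l) \<le> real k ^ l"
    using c by linarith
  then have "(real (k choose l))\<^sup>2 * fact l \<le> real k ^ l * real k ^ l"
    using mult_mono[OF _ c, of "real (k choose l)" "real k ^ l"] by (simp add: power2_eq_square mult.assoc)
  then have "(real (k choose l))\<^sup>2 * fact l * q ^ (l choose 2) \<le> (real k ^ l * real k ^ l) * sqrt (real k * real n) ^ l"
    by (rule mult_mono[OF _ qle]) (use q in auto)
  then have "overlap_bound q n k l \<le> (real k ^ l * real k ^ l) * sqrt (real k * real n) ^ l / real (n - k) ^ l"
    unfolding overlap_bound_def by (intro divide_right_mono) auto
  also have "\<dots> = b ^ l"
    by (simp add: b_def power_divide power_mult_distrib power2_eq_square)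
  also have "\<dots> \<le> b ^ 1"
    using b l by (intro power_decreasing) (auto simp: b_def)
  finally show ?thesis
    by (simp add: b_def)
qed

text \<open>
  The bound is small as long as \<open>q ^ l \<le> k n\<close> and increasing in \<open>l\<close> from there on.
\<close>

lemma overlap_sum_le:
  assumes q: "q > 1" and k: "k < n"
    and b: "(real k)\<^sup>2 * sqrt (real k * real n) / real (n - k) \<le> 1"
  shows "(\<Sum>l=1..k. real ((k choose l) * ((n - k) choose (k - l))) / real (n choose k) * q ^ (l choose 2))
    \<le> real k * ((real k)\<^sup>2 * sqrt (real k * real n) / real (n - k) +
                 fact k * q ^ (k choose 2) / real (n - k) ^ k)"
proof -
  let ?b = "(real k)\<^sup>2 * sqrt (real k * real n) / real (n - k)"
  let ?a = "fact k * q ^ (k choose 2) / real (n - k) ^ k"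
  have "real ((k choose l) * ((n - k) choose (k - l))) / real (n choose k) * q ^ (l choose 2) \<le> ?b + ?a"
    if l: "l \<in> {1..k}" for l
  proof -
    have "overlap_bound q n k l \<le> ?b + ?a"
    proof (cases "q ^ l \<le> real k * real n")
      case True
      have "0 \<le> ?a"
        using q by simp
      then show ?thesis
        using overlap_bound_le_small[OF q k _ _ True b] l by simp
    next
      case False
      have "l \<le> k"
        using l by simp
      then have "overlap_bound q n k l \<le> overlap_bound q n k k"
      proof (rule inc_induct)
        fix j assume j: "l \<le> j" "j < k" "overlap_bound q n k (Suc j) \<le> overlap_bound q n k k"
        have "q ^ l \<le> q ^ j"
          using q j by (intro power_increasing) auto
        then show "overlap_bound q n k j \<le> overlap_bound q n k k"
          using overlap_bound_step[OF q k j(2)] False j(3) by linarith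
      qed simp
      then show ?thesis
        by (simp add: overlap_bound_def add_increasing)
    qed
    then show ?thesis
      using overlap_term_le[OF _ k, of q l] q l by fastforce
  qed
  from sum_bounded_above[of "{1..k}", OF this] show ?thesis
    by simp
qed

lemma power_choose_two_powr:
  assumes "q > 0" "k \<ge> 1"
  shows "q ^ (k choose 2) = (q powr ((real k - 1) / 2)) ^ k"
proof -
  have "q ^ (k choose 2) \<ge> 0" "(q powr ((real k - 1) / 2)) ^ k \<ge> 0"
    using assms by auto
  moreover have "((q powr ((real k - 1) / 2)) ^ k)\<^sup>2 = (q ^ (k - 1)) ^ k"
  proof -
    have "((q powr ((real k - 1) / 2)) ^ k)\<^sup>2 = ((q powr ((real k - 1) / 2))\<^sup>2) ^ k"
      by (metis power_mult mult.commute)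
    also have "(q powr ((real k - 1) / 2))\<^sup>2 = q powr ((real k - 1) / 2 + (real k - 1) / 2)"
      by (simp only: powr_add power2_eq_square)
    also have "(real k - 1) / 2 + (real k - 1) / 2 = real (k - 1)"
      using assms by (simp add: of_nat_diff)
    also have "q powr real (k - 1) = q ^ (k - 1)"
      using assms(1) by (rule powr_realpow)
    finally show ?thesis .
  qed
  ultimately show ?thesis
    using power_choose_two[of q k] by (metis power2_eq_iff_nonneg)
qed

section \<open>Asymptotics around the clique threshold\<close>

context
  fixes p q \<epsilon> :: real
  assumes p: "0 < p" "p < 1" and q_def: "q = 1 / p" and \<epsilon>: "\<epsilon> > 0"
begin

lemma q_gt_1: "q > 1"
  using p by (simp add: q_def)

lemma ln_q_pos: "ln q > 0"
  using q_gt_1 by simp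

text \<open>The source of the constants in z: they make q^((z-1)/2) equal to e n / k at k = 2 log_q
  n. Both moment estimates use z through this identity.\<close>

lemma powr_clique_threshold:
  assumes "n > 1"
  shows "q powr ((clique_threshold p n - 1) / 2) = real n / log q n * (exp 1 / 2)"
proof -
  have L: "log q n > 0"
    using assms q_gt_1 by simp
  have "(clique_threshold p n - 1) / 2 = log q n - log q (log q n) + log q (exp 1 / 2)"
    by (simp add: clique_threshold_def Let_def q_def field_simps)
  then have "q powr ((clique_threshold p n - 1) / 2) =
      q powr (log q n) / q powr (log q (log q n)) * q powr (log q (exp 1 / 2))"
    by (simp only: powr_add powr_diff)
  then show ?thesis
    using assms q_gt_1 L by simp
qed

lemma filterlim_log_q: "filterlim (\<lambda>n. log q (real n)) at_top sequentially"
proof -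
  have "filterlim (\<lambda>n::nat. ln (real n) / b) at_top sequentially" if "b > 0" for b :: real
    using that by real_asymp
  from this[OF ln_q_pos] show ?thesis
    by (simp add: log_def)
qed

text \<open>As a function of t = log_q n alone, the threshold can be compared with t as t tends to
  infinity, and the result transferred by \<open>filterlim_log_q\<close>.\<close>

lemma clique_threshold_log:
  "clique_threshold p n = 2 * log q n - 2 * (ln (log q n) / ln q) + (2 * log q (exp 1 / 2) + 1)"
  by (simp add: clique_threshold_def Let_def q_def log_def)

lemma eventually_clique_threshold_ge: "\<forall>\<^sub>F n in sequentially. log q n \<le> clique_threshold p n + c"
proof -
  have "filterlim (\<lambda>t. t - 2 * (ln t / b) + C) at_top at_top" if "b > 0" for b C :: real
    using that by real_asymp
  from this[OF ln_q_pos, of "(2 * log q (exp 1 / 2) + 1) + c"]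
  have "\<forall>\<^sub>F t in at_top. 0 \<le> t - 2 * (ln t / ln q) + ((2 * log q (exp 1 / 2) + 1) + c)"
    by (simp add: filterlim_at_top)
  from eventually_compose_filterlim[OF this filterlim_log_q] show ?thesis
    by eventually_elim (simp add: clique_threshold_log)
qed

lemma eventually_clique_threshold_le: "\<forall>\<^sub>F n in sequentially. clique_threshold p n + c \<le> 2 * log q n"
proof -
  have "filterlim (\<lambda>t. 2 * (ln t / b) + C) at_top at_top" if "b > 0" for b C :: real
    using that by real_asymp
  from this[OF ln_q_pos, of "- (2 * log q (exp 1 / 2) + 1) - c"]
  have "\<forall>\<^sub>F t in at_top. 0 \<le> 2 * (ln t / ln q) + (- (2 * log q (exp 1 / 2) + 1) - c)"
    by (simp add: filterlim_at_top)
  from eventually_compose_filterlim[OF this filterlim_log_q] show ?thesis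
    by eventually_elim (simp add: clique_threshold_log)
qed

lemma eventually_clique_threshold_asymp:
  assumes "r > 1"
  shows "\<forall>\<^sub>F n in sequentially. 2 * log q n \<le> r * clique_threshold p n"
proof -
  have "((\<lambda>t. (2 * t - 2 * (ln t / b) + C) / (2 * t)) \<longlongrightarrow> 1) at_top" if "b > 0" for b C :: real
    using that by real_asymp
  from order_tendstoD(1)[OF this[OF ln_q_pos, of "2 * log q (exp 1 / 2) + 1"], of "1 / r"]
  have "\<forall>\<^sub>F t in at_top. 1 / r < (2 * t - 2 * (ln t / ln q) + (2 * log q (exp 1 / 2) + 1)) / (2 * t)"
    using assms by simp
  then have "\<forall>\<^sub>F t in at_top. 2 * t \<le> r * (2 * t - 2 * (ln t / ln q) + (2 * log q (exp 1 / 2) + 1))"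
    using eventually_gt_at_top[of 0]
  proof eventually_elim
    case (elim t)
    then show ?case
      using assms by (simp add: field_simps)
  qed
  from eventually_compose_filterlim[OF this filterlim_log_q] show ?thesis
    by eventually_elim (simp only: clique_threshold_log)
qed

lemma eventually_log_less: "\<forall>\<^sub>F n in sequentially. 2 * log q n < real n"
proof -
  have "\<forall>\<^sub>F n::nat in sequentially. 2 * (ln (real n) / B) < real n" if "B > 0" for B :: real
    using that by real_asymp
  from this[OF ln_q_pos] show ?thesis
    by (simp add: log_def)
qed

lemma log_powr_tendsto_0:
  assumes "c > 0"
  shows "(\<lambda>n. (log q (real n))\<^sup>2 * q powr (- c * log q (real n))) \<longlonglongrightarrow> 0"
    and "(\<lambda>n. q powr (- c * log q (real n))) \<longlonglongrightarrow> 0"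
proof -
  have *: "((\<lambda>t. t\<^sup>2 * exp (- b * t)) \<longlongrightarrow> 0) at_top" "((\<lambda>t. exp (- b * t)) \<longlongrightarrow> 0) at_top" if "b > 0" for b :: real
    using that by real_asymp+
  have "c * ln q > 0"
    using assms ln_q_pos by simp
  note ** = *[OF this, THEN filterlim_compose, OF filterlim_log_q]
  show "(\<lambda>n. (log q (real n))\<^sup>2 * q powr (- c * log q (real n))) \<longlonglongrightarrow> 0"
    "(\<lambda>n. q powr (- c * log q (real n))) \<longlonglongrightarrow> 0"
    using ** q_gt_1 by (simp_all add: powr_def mult_ac)
qed

lemma first_moment_tendsto_0:
  defines "k \<equiv> \<lambda>n. Suc (nat \<lfloor>clique_threshold p n + \<epsilon>\<rfloor>)"
  shows "(\<lambda>n. real (n choose k n) * p ^ (k n choose 2)) \<longlonglongrightarrow> 0"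
proof (rule tendsto_sandwich[where f = "\<lambda>_. 0"])
  \<comment> \<open>Half of the gain q^(-\<epsilon>/2) is set aside as \<open>r\<close> to absorb
    the ratio 2 log_q n / k, which is eventually at most r.\<close>
  define r where "r = q powr (\<epsilon> / 4)"
  have r: "r > 1"
    using q_gt_1 \<epsilon> by (simp add: r_def gr_one_powr)
  show "(\<lambda>n. q powr (- (\<epsilon> / 4) * log q (real n))) \<longlonglongrightarrow> 0"
    using \<epsilon> by (intro log_powr_tendsto_0) simp
  show "\<forall>\<^sub>F n in sequentially. real (n choose k n) * p ^ (k n choose 2) \<le> q powr (- (\<epsilon> / 4) * log q (real n))"
    using eventually_clique_threshold_ge[of 0] eventually_clique_threshold_asymp[OF r]
      eventually_gt_at_top[of 1] filterlim_log_q[unfolded filterlim_at_top, rule_format, of 1]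
  proof eventually_elim
    case (elim n)
    define z where "z = clique_threshold p n"
    define L where "L = log q (real n)"
    have L: "L \<ge> 1" "L \<le> z" "2 * L \<le> r * z"
      using elim by (simp_all add: L_def z_def)
    have "0 \<le> \<lfloor>z + \<epsilon>\<rfloor>"
      using L \<epsilon> by simp
    then have "real (k n) = real_of_int \<lfloor>z + \<epsilon>\<rfloor> + 1"
      by (simp add: k_def z_def)
    then have kz: "real (k n) > z + \<epsilon>"
      by linarith
    then have k0: "real (k n) > 0"
      using L \<epsilon> by linarith
    define B where "B = q powr (- ((real (k n) - 1) / 2))"
    have pk: "p ^ (k n choose 2) = B ^ k n"
    proof -
      have "p ^ (k n choose 2) = (p powr ((real (k n) - 1) / 2)) ^ k n"
        using p by (intro power_choose_two_powr) (auto simp: k_def)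
      also have "p powr ((real (k n) - 1) / 2) = B"
        using p by (simp add: B_def q_def powr_minus_divide powr_divide)
      finally show ?thesis .
    qed
    have B_le: "B \<le> 2 * L / (exp 1 * real n) * q powr (- (\<epsilon> / 2))"
    proof -
      have "B \<le> q powr (- ((z - 1) / 2) + - (\<epsilon> / 2))"
        unfolding B_def using kz q_gt_1 by (intro powr_mono) (auto simp: field_simps)
      also have "\<dots> = inverse (q powr ((z - 1) / 2)) * q powr (- (\<epsilon> / 2))"
        by (simp only: powr_add powr_minus)
      also have "q powr ((z - 1) / 2) = real n / L * (exp 1 / 2)"
        unfolding z_def L_def by (rule powr_clique_threshold) (use elim in auto)
      finally show ?thesis
        using L elim by (simp add: field_simps)
    qed
    have "real (n choose k n) * (real (k n) / exp 1) ^ k n \<le> real (n choose k n) * fact (k n)"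
      by (intro mult_left_mono fact_ge_div_exp_power) auto
    also have "\<dots> \<le> real n ^ k n"
      using binomial_fact_pow[of n "k n"] by (metis of_nat_fact of_nat_le_iff of_nat_mult of_nat_power)
    finally have "real (n choose k n) \<le> (exp 1 * real n / real (k n)) ^ k n"
      using k0 by (simp add: power_divide power_mult_distrib field_simps)
    then have "real (n choose k n) * p ^ (k n choose 2) \<le> (exp 1 * real n / real (k n)) ^ k n * B ^ k n"
      unfolding pk by (intro mult_right_mono) (auto simp: B_def)
    also have "\<dots> = (exp 1 * real n / real (k n) * B) ^ k n"
      by (simp only: power_mult_distrib)
    also have "\<dots> \<le> (q powr (- (\<epsilon> / 4))) ^ k n"
    proof (rule power_mono)
      have "exp 1 * real n / real (k n) * B \<le> exp 1 * real n / real (k n) * (2 * L / (exp 1 * real n) * q powr (- (\<epsilon> / 2)))"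
        by (intro mult_left_mono B_le) auto
      also have "\<dots> = 2 * L / real (k n) * q powr (- (\<epsilon> / 2))"
        using elim k0 by (simp add: field_simps)
      also have "\<dots> \<le> r * q powr (- (\<epsilon> / 2))"
      proof (rule mult_right_mono)
        have "2 * L \<le> r * real (k n)"
          using L(3) kz r \<epsilon> by (smt (verit, best) mult_left_mono)
        then show "2 * L / real (k n) \<le> r"
          using k0 by (simp add: field_simps)
      qed auto
      also have "\<dots> = q powr (- (\<epsilon> / 4))"
        unfolding r_def by (simp add: powr_add[symmetric])
      finally show "exp 1 * real n / real (k n) * B \<le> q powr (- (\<epsilon> / 4))" .
    qed (auto simp: B_def)
    also have "\<dots> = q powr (- (\<epsilon> / 4) * real (k n))"
      using q_gt_1 by (simp add: powr_power mult.commute)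
    also have "\<dots> \<le> q powr (- (\<epsilon> / 4) * L)"
      using q_gt_1 kz L \<epsilon> by (intro powr_mono) auto
    finally show ?case
      by (simp add: L_def)
  qed
qed (use p in \<open>auto intro!: always_eventually\<close>)

lemma second_moment_tendsto_0:
  defines "k \<equiv> \<lambda>n. nat \<lfloor>clique_threshold p n - \<epsilon>\<rfloor>"
  shows "(\<lambda>n. \<Sum>l=1..k n. real ((k n choose l) * ((n - k n) choose (k n - l))) / real (n choose k n) *
                 q ^ (l choose 2)) \<longlonglongrightarrow> 0"
proof (rule tendsto_sandwich[where f = "\<lambda>_. 0"])
  \<comment> \<open>Here \<open>r\<close> absorbs n / (n - 2 log_q n), the cost of replacing n by n
    - k in the denominators.\<close>
  define r where "r = q powr (\<epsilon> / 4)"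
  have r: "r > 1"
    using q_gt_1 \<epsilon> by (simp add: r_def gr_one_powr)
  \<comment> \<open>An upper bound for the k small-overlap terms together, from k \<le> 2 log_q n;
    it decays like n^(-1/2) up to powers of the logarithm.\<close>
  define b where "b = (\<lambda>n. (2 * log q n) ^ 3 * sqrt (2 * log q n * real n) / (real n - 2 * log q n))"
  have b: "b \<longlonglongrightarrow> 0"
  proof -
    have "(\<lambda>n::nat. (2 * (ln (real n) / B)) ^ 3 * sqrt (2 * (ln (real n) / B) * real n) /
        (real n - 2 * (ln (real n) / B))) \<longlonglongrightarrow> 0" if "B > 0" for B :: real
      using that by real_asymp
    from this[OF ln_q_pos] show ?thesis
      by (simp add: b_def log_def)
  qed
  have ratio: "(\<lambda>n. real n / (real n - 2 * log q n)) \<longlonglongrightarrow> 1"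
  proof -
    have "(\<lambda>n::nat. real n / (real n - 2 * (ln (real n) / B))) \<longlonglongrightarrow> 1" if "B > 0" for B :: real
      using that by real_asymp
    from this[OF ln_q_pos] show ?thesis
      by (simp add: log_def)
  qed
  show "(\<lambda>n. b n + 4 * exp 1 * ((log q (real n))\<^sup>2 * q powr (- (\<epsilon> / 4) * log q (real n)))) \<longlonglongrightarrow> 0"
  proof -
    have "(\<lambda>n. 4 * exp 1 * ((log q (real n))\<^sup>2 * q powr (- (\<epsilon> / 4) * log q (real n)))) \<longlonglongrightarrow> 4 * exp 1 * 0"
      using \<epsilon> by (intro tendsto_mult_left log_powr_tendsto_0(1)) simp
    from tendsto_add[OF b this] show ?thesis
      by simp
  qed
  show "\<forall>\<^sub>F n in sequentially. (\<Sum>l=1..k n. real ((k n choose l) * ((n - k n) choose (k n - l))) /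
      real (n choose k n) * q ^ (l choose 2))
    \<le> b n + 4 * exp 1 * ((log q (real n))\<^sup>2 * q powr (- (\<epsilon> / 4) * log q (real n)))"
    using eventually_clique_threshold_ge[of "- \<epsilon> - 1"] eventually_clique_threshold_le[of "- \<epsilon>"]
      order_tendstoD(2)[OF b zero_less_one] order_tendstoD(2)[OF ratio r] eventually_log_less
      eventually_gt_at_top[of 1] filterlim_log_q[unfolded filterlim_at_top, rule_format, of 1]
  proof eventually_elim
    case (elim n)
    define z where "z = clique_threshold p n"
    define L where "L = log q (real n)"
    define K where "K = real (k n)"
    have L: "L \<ge> 1" "L \<le> z - \<epsilon> - 1" "z - \<epsilon> \<le> 2 * L" "2 * L < real n"
      "real n / (real n - 2 * L) < r"
      using elim by (simp_all add: L_def z_def)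
    have K: "K \<le> z - \<epsilon>" "L \<le> K"
      using of_int_floor_le[of "z - \<epsilon>"] real_of_int_floor_add_one_gt[of "z - \<epsilon>"] L \<epsilon>
      unfolding K_def k_def z_def[symmetric] by linarith+
    then have K2: "K \<le> 2 * L" "1 \<le> K" "K < real n"
      using L by linarith+
    then have kn: "k n < n" "k n \<ge> 1"
      by (simp_all add: K_def)
    have nk: "real (n - k n) = real n - K"
      using kn by (simp add: K_def)
    have nK: "0 < real n - 2 * L" "real n - 2 * L \<le> real n - K"
      using K2 L by auto
    let ?b = "(real (k n))\<^sup>2 * sqrt (real (k n) * real n) / real (n - k n)"
    have kb: "K * ?b \<le> b n"
    proof -
      have "K * ?b = K ^ 3 * sqrt (K * real n) / (real n - K)"
        unfolding nk K_def[symmetric] by (simp add: power2_eq_square power3_eq_cube)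
      also have "\<dots> \<le> (2 * L) ^ 3 * sqrt (2 * L * real n) / (real n - 2 * L)"
        using K2 L nK by (intro frac_le mult_mono power_mono real_sqrt_le_mono mult_right_mono) auto
      finally show ?thesis
        by (simp add: b_def L_def)
    qed
    have "?b \<le> K * ?b"
      using K2 by (intro mult_right_mono[of 1 K, simplified]) auto
    also note kb
    also have "b n \<le> 1"
      using elim(3) by simp
    finally have b1: "?b \<le> 1" .
    have "fact (k n) * q ^ (k n choose 2) / real (n - k n) ^ k n \<le> exp 1 * K * (q powr (- (\<epsilon> / 4))) ^ k n"
    proof -
      define B where "B = q powr ((K - 1) / 2)"
      have qk: "q ^ (k n choose 2) = B ^ k n"
        unfolding B_def K_def using q_gt_1 kn by (intro power_choose_two_powr) auto
      have B_le: "B \<le> real n / L * (exp 1 / 2) * q powr (- (\<epsilon> / 2))"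
      proof -
        have "B \<le> q powr ((z - 1) / 2 + - (\<epsilon> / 2))"
          unfolding B_def using K q_gt_1 by (intro powr_mono) (auto simp: field_simps)
        also have "\<dots> = q powr ((z - 1) / 2) * q powr (- (\<epsilon> / 2))"
          by (simp only: powr_add)
        also have "q powr ((z - 1) / 2) = real n / L * (exp 1 / 2)"
          unfolding z_def L_def by (rule powr_clique_threshold) (use elim in auto)
        finally show ?thesis .
      qed
      have "fact (k n) * q ^ (k n choose 2) / real (n - k n) ^ k n
          \<le> exp 1 * K * (K / exp 1) ^ k n * B ^ k n / (real n - K) ^ k n"
        unfolding qk nk using fact_le_div_exp_power[OF kn(2)] nK K2
        by (intro divide_right_mono mult_right_mono) (auto simp: K_def B_def)
      also have "\<dots> = exp 1 * K * (K / exp 1 * B / (real n - K)) ^ k n"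
        by (simp only: power_mult_distrib power_divide) simp
      also have "\<dots> \<le> exp 1 * K * (q powr (- (\<epsilon> / 4))) ^ k n"
      proof (intro mult_left_mono power_mono)
        have "K / exp 1 * B / (real n - K)
            \<le> 2 * L / exp 1 * (real n / L * (exp 1 / 2) * q powr (- (\<epsilon> / 2))) / (real n - 2 * L)"
          using K2 L nK B_le by (intro frac_le mult_mono divide_right_mono) (auto simp: B_def)
        also have "\<dots> = real n / (real n - 2 * L) * q powr (- (\<epsilon> / 2))"
          using L nK by (simp add: field_simps)
        also have "\<dots> \<le> r * q powr (- (\<epsilon> / 2))"
          using L by (intro mult_right_mono) auto
        also have "\<dots> = q powr (- (\<epsilon> / 4))"
          unfolding r_def by (simp add: powr_add[symmetric])
        finally show "K / exp 1 * B / (real n - K) \<le> q powr (- (\<epsilon> / 4))" .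
      qed (use K2 in \<open>auto simp: B_def\<close>)
      finally show ?thesis .
    qed
    also have "(q powr (- (\<epsilon> / 4))) ^ k n = q powr (- (\<epsilon> / 4) * K)"
      using q_gt_1 by (simp add: powr_power mult.commute K_def)
    finally have "K * (fact (k n) * q ^ (k n choose 2) / real (n - k n) ^ k n)
        \<le> K * (exp 1 * K * q powr (- (\<epsilon> / 4) * K))"
      using K2 by (intro mult_left_mono) auto
    also have "\<dots> = exp 1 * (K\<^sup>2 * q powr (- (\<epsilon> / 4) * K))"
      by (simp add: power2_eq_square)
    also have "\<dots> \<le> exp 1 * ((2 * L)\<^sup>2 * q powr (- (\<epsilon> / 4) * L))"
    proof (intro mult_left_mono)
      have "K\<^sup>2 \<le> (2 * L)\<^sup>2"
        using K2 by (intro power_mono) auto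
      moreover have "q powr (- (\<epsilon> / 4) * K) \<le> q powr (- (\<epsilon> / 4) * L)"
        using K q_gt_1 \<epsilon> by (intro powr_mono) auto
      ultimately show "K\<^sup>2 * q powr (- (\<epsilon> / 4) * K) \<le> (2 * L)\<^sup>2 * q powr (- (\<epsilon> / 4) * L)"
        by (rule mult_mono) auto
    qed auto
    finally have ka: "K * (fact (k n) * q ^ (k n choose 2) / real (n - k n) ^ k n)
        \<le> 4 * exp 1 * (L\<^sup>2 * q powr (- (\<epsilon> / 4) * L))"
      by (simp add: power_mult_distrib)
    have "(\<Sum>l=1..k n. real ((k n choose l) * ((n - k n) choose (k n - l))) /
        real (n choose k n) * q ^ (l choose 2)) \<le>
        K * (?b + fact (k n) * q ^ (k n choose 2) / real (n - k n) ^ k n)"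
      unfolding K_def by (rule overlap_sum_le[OF q_gt_1 kn(1) b1])
    also have "\<dots> \<le> b n + 4 * exp 1 * (L\<^sup>2 * q powr (- (\<epsilon> / 4) * L))"
      unfolding distrib_left using kb ka by (rule add_mono)
    finally show ?case
      by (simp add: L_def)
  qed
qed (use q_gt_1 in \<open>auto intro!: always_eventually sum_nonneg\<close>)

end

theorem theorem1p4:
  fixes \<epsilon> p :: real and s :: nat
  assumes "\<epsilon> > 0" and "s \<ge> 1" and "0 < p" and "p < 1"
  shows "(\<lambda>n. measure_pmf.prob (random_graph n p)
            {\<Gamma>. ereal (real_of_int (int s * \<lfloor>clique_threshold p n - \<epsilon>\<rfloor>))
                  \<le> ereal_of_enat (higher_TC s (raag_complex n \<Gamma>)) \<and>
                ereal_of_enat (higher_TC s (raag_complex n \<Gamma>))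
                  \<le> ereal (real_of_int (int s * \<lfloor>clique_threshold p n + \<epsilon>\<rfloor>))})
         \<longlonglongrightarrow> 1"
proof -
  define q where "q = 1 / p"
  define w where "w = (\<lambda>n. nat \<lfloor>clique_threshold p n + \<epsilon>\<rfloor>)"
  define k where "k = (\<lambda>n. nat \<lfloor>clique_threshold p n - \<epsilon>\<rfloor>)"
  define good where "good = (\<lambda>n. {\<Gamma>. ereal (real_of_int (int s * \<lfloor>clique_threshold p n - \<epsilon>\<rfloor>))
                  \<le> ereal_of_enat (higher_TC s (raag_complex n \<Gamma>)) \<and>
                ereal_of_enat (higher_TC s (raag_complex n \<Gamma>))
                  \<le> ereal (real_of_int (int s * \<lfloor>clique_threshold p n + \<epsilon>\<rfloor>))})"
  \<comment> \<open>One size suffices for the union bound, since a larger clique contains one of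
    size \<open>Suc (w n)\<close>.\<close>
  define large where "large = (\<lambda>n. {\<Gamma>. \<exists>A\<in>nsets {1..n} (Suc (w n)). clique A \<Gamma>})"
  define sparse where "sparse = (\<lambda>n. {\<Gamma>. \<not> (\<exists>A\<in>nsets {1..n} (k n). \<exists>B\<in>nsets {1..n} (k n).
      clique A \<Gamma> \<and> clique B \<Gamma> \<and> A \<inter> B = {})})"
  note asymp = assms(3,4) q_def assms(1)
  define f where "f = (\<lambda>n. real (n choose Suc (w n)) * p ^ (Suc (w n) choose 2))"
  define g where "g = (\<lambda>n. 4 * (\<Sum>l=1..k n. real ((k n choose l) * ((n - k n) choose (k n - l))) /
      real (n choose k n) * q ^ (l choose 2)))"
  have f: "f \<longlonglongrightarrow> 0"
    unfolding f_def w_def by (rule first_moment_tendsto_0[OF asymp])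
  have "g \<longlonglongrightarrow> 4 * 0"
    unfolding g_def k_def by (intro tendsto_mult_left second_moment_tendsto_0[OF asymp])
  with f have lim: "(\<lambda>n. 1 - (f n + g n)) \<longlonglongrightarrow> 1"
    using tendsto_diff[OF tendsto_const tendsto_add[of f 0 sequentially g 0], of 1] by simp
  have "\<forall>\<^sub>F n in sequentially. 1 - (f n + g n) \<le> measure_pmf.prob (random_graph n p) (good n)"
    using eventually_clique_threshold_ge[OF asymp, of "- \<epsilon>"] eventually_clique_threshold_le[OF asymp, of "- \<epsilon>"]
      eventually_log_less[OF asymp] filterlim_log_q[OF asymp, unfolded filterlim_at_top, rule_format, of 1]
  proof eventually_elim
    case (elim n)
    let ?M = "measure_pmf (random_graph n p)"
    \<comment> \<open>Eventually both floors are nonnegative, so that \<open>nat\<close> does not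
      truncate them.\<close>
    have fl: "0 \<le> \<lfloor>clique_threshold p n - \<epsilon>\<rfloor>" "0 \<le> \<lfloor>clique_threshold p n + \<epsilon>\<rfloor>"
      using elim assms(1) by simp_all
    then have kw: "real (k n) = real_of_int \<lfloor>clique_threshold p n - \<epsilon>\<rfloor>"
      "real (w n) = real_of_int \<lfloor>clique_threshold p n + \<epsilon>\<rfloor>"
      by (simp_all add: k_def w_def)
    then have "real (k n) \<le> real n"
      using elim of_int_floor_le[of "clique_threshold p n - \<epsilon>"] by linarith
    then have kn: "k n \<le> n"
      by simp
    have "- good n \<subseteq> large n \<union> sparse n"
    proof (rule subsetI, rule ccontr)
      fix \<Gamma> assume bad: "\<Gamma> \<in> - good n" and "\<Gamma> \<notin> large n \<union> sparse n"
      then have no: "\<not> (\<exists>A\<in>nsets {1..n} (Suc (w n)). clique A \<Gamma>)"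
        and "\<exists>A\<in>nsets {1..n} (k n). \<exists>B\<in>nsets {1..n} (k n). clique A \<Gamma> \<and> clique B \<Gamma> \<and> A \<inter> B = {}"
        by (simp_all add: large_def sparse_def)
      then have lower: "enat (s * k n) \<le> higher_TC s (raag_complex n \<Gamma>)"
        using higher_TC_raag_complex_ge_disjoint_cliques[OF assms(2)] by blast
      have upper: "higher_TC s (raag_complex n \<Gamma>) \<le> enat (s * w n)"
      proof (rule higher_TC_raag_complex_le[OF assms(2)], rule ccontr)
        fix K assume K: "K \<subseteq> {1..n}" "clique K \<Gamma>" "\<not> card K \<le> w n"
        then obtain A where A: "A \<subseteq> K" "card A = Suc (w n)" "finite A"
          by (metis not_less_eq_eq obtain_subset_with_card_n)
        then have "A \<in> nsets {1..n} (Suc (w n))" "clique A \<Gamma>"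
          using K by (auto simp: nsets_def clique_def)
        then show False
          using no by blast
      qed
      \<comment> \<open>The upper bound makes the value finite, and the comparison moves from
        \<open>enat\<close> to the reals.\<close>
      obtain m where m: "higher_TC s (raag_complex n \<Gamma>) = enat m"
        using upper enat_ile by blast
      have "real (s * k n) \<le> real m" "real m \<le> real (s * w n)"
        using lower upper unfolding m by (simp_all only: enat_ord_simps of_nat_le_iff)
      then have "\<Gamma> \<in> good n"
        by (simp add: good_def m kw)
      with bad show False
        by simp
    qed
    then have "measure ?M (- good n) \<le> measure ?M (large n \<union> sparse n)"
      by (intro measure_pmf.finite_measure_mono) auto
    also have "\<dots> \<le> measure ?M (large n) + measure ?M (sparse n)"
      by (rule measure_Un_le) auto
    also have "\<dots> \<le> f n + g n"
      unfolding large_def sparse_def f_def g_def q_def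
      by (intro add_mono prob_ex_clique_le prob_no_disjoint_cliques_le kn) (use assms in auto)
    finally show ?case
      using measure_pmf.prob_compl[of "good n" "random_graph n p"] by (simp add: Compl_eq_Diff_UNIV)
  qed
  then have "(\<lambda>n. measure_pmf.prob (random_graph n p) (good n)) \<longlonglongrightarrow> 1"
    by (rule tendsto_sandwich[OF _ _ lim tendsto_const]) (simp add: always_eventually)
  then show ?thesis
    by (simp only: good_def)
qed

end
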